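(* For every $s\in\mathbb{R}$, the unitary representation $\pi_s$ of Thompson's group $F$ on $L^2([0,1])$ given by $\pi_s(\gamma) f = \left(\frac{d\gamma_*\mu}{d\mu}\right)^{1/2+is} \, f\circ\gamma^{-1}$, where $\mu$ is the Lebesgue measure on $[0,1]$, is irreducible.
   Context: Thompson's group $F$ consists of all orientation-preserving piecewise linear homeomorphisms $\phi$ of the unit interval $[0,1]$ such that (1) $\phi$ preserves the set $\mathbb{Z}[1/2]\cap[0,1]$ of dyadic rationals in $[0,1]$; (2) $\phi$ has finitely many nondifferentiability points, all lying in $\mathbb{Z}[1/2]$; (3) the slopes of $\phi$ are of the form $2^k$, $k\in\mathbb{Z}$. $F$ is regarded as a discrete group. $\mu$ is the Lebesgue measure on $[0,1]$, which is quasi-invariant under $F$; $\gamma_*\mu$ is the pushforward of $\mu$ and $d\gamma_*\mu/d\mu$ its Radon–Nikodym derivative (an almost everywhere positive function). $L^2([0,1])$ is the complex Hilbert space with respect to $\mu$. *)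

theory Defs
  imports "HOL-Analysis.Analysis" "HOL-Algebra.Bij"
begin

section \<open>Complex Hilbert spaces\<close>

text \<open>
  The complex inner product is linear in its first argument; the underlying real Hilbert space
  structure (hence norm, topology and completeness) is the library's, with real inner product
  the real part of the complex one.
\<close>

class complex_inner = real_inner +
  fixes scaleC :: "complex \<Rightarrow> 'a \<Rightarrow> 'a" (infixr "*\<^sub>C" 75)
    and cinner :: "'a \<Rightarrow> 'a \<Rightarrow> complex"
  assumes scaleC_add_right: "c *\<^sub>C (x + y) = c *\<^sub>C x + c *\<^sub>C y"
    and scaleC_add_left: "(c + d) *\<^sub>C x = c *\<^sub>C x + d *\<^sub>C x"
    and scaleC_scaleC: "c *\<^sub>C (d *\<^sub>C x) = (c * d) *\<^sub>C x"
    and scaleC_one: "1 *\<^sub>C x = x"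
    and scaleR_scaleC: "scaleR r x = complex_of_real r *\<^sub>C x"
    and cinner_commute: "cinner x y = cnj (cinner y x)"
    and cinner_add_left: "cinner (x + y) z = cinner x z + cinner y z"
    and cinner_scaleC_left: "cinner (c *\<^sub>C x) y = c * cinner x y"
    and inner_eq_Re_cinner: "inner x y = Re (cinner x y)"

class complex_hilbert_space = complex_inner + complete_space

lemma vector_space_scaleC: "vector_space (scaleC :: complex \<Rightarrow> 'a \<Rightarrow> 'a::complex_inner)"
  by standard (auto simp: scaleC_add_right scaleC_add_left scaleC_scaleC scaleC_one)


section \<open>Irreducible unitary representations of discrete groups\<close>

definition unitary :: "('a \<Rightarrow> 'a::complex_hilbert_space) \<Rightarrow> bool" where
  "unitary U \<longleftrightarrow> Vector_Spaces.linear scaleC scaleC U \<and> surj U \<and>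
     (\<forall>x y. cinner (U x) (U y) = cinner x y)"

definition unitary_group :: "('a \<Rightarrow> 'a::complex_hilbert_space) monoid" where
  "unitary_group = \<lparr>carrier = {U. unitary U}, mult = (\<circ>), one = id\<rparr>"

definition unitary_rep :: "('g, 'm) monoid_scheme \<Rightarrow> ('g \<Rightarrow> 'a \<Rightarrow> 'a::complex_hilbert_space) \<Rightarrow> bool"
  where "unitary_rep G \<pi> \<longleftrightarrow> group G \<and> \<pi> \<in> hom G unitary_group"

definition irreducible_unitary_rep ::
    "('g, 'm) monoid_scheme \<Rightarrow> ('g \<Rightarrow> 'a \<Rightarrow> 'a::complex_hilbert_space) \<Rightarrow> bool" where
  "irreducible_unitary_rep G \<pi> \<longleftrightarrow> unitary_rep G \<pi> \<and> (UNIV :: 'a set) \<noteq> {0} \<and>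
     (\<forall>W. closed W \<and> module.subspace scaleC W \<and> (\<forall>g\<in>carrier G. \<pi> g ` W \<subseteq> W)
        \<longrightarrow> W = {0} \<or> W = UNIV)"


section \<open>Thompson's group F\<close>

definition dyadic :: "real set" where
  "dyadic = {of_int a / 2 ^ n | a n. True}"

definition piecewise_linear :: "(real \<Rightarrow> real) \<Rightarrow> bool" where
  "piecewise_linear \<phi> \<longleftrightarrow> (\<exists>P. finite P \<and>
     (\<forall>u v. 0 \<le> u \<and> u < v \<and> v \<le> 1 \<and> P \<inter> {u<..<v} = {}
        \<longrightarrow> (\<exists>m c. \<forall>t\<in>{u..v}. \<phi> t = m * t + c)))"

text \<open>
  As in \<^const>\<open>BijGroup\<close>, homeomorphisms of the interval are represented by functions that are
  extensional on it, so that equality of group elements is equality on the interval.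
  Derivatives at the end points are one-sided.
\<close>

definition thompson_carrier :: "(real \<Rightarrow> real) set" where
  "thompson_carrier = {\<phi> \<in> extensional {0..1}.
     (\<exists>\<psi>. homeomorphism {0..1} {0..1} \<phi> \<psi>) \<and>
     strict_mono_on {0..1} \<phi> \<and>
     piecewise_linear \<phi> \<and>
     \<phi> ` (dyadic \<inter> {0..1}) = dyadic \<inter> {0..1} \<and>
     finite {x\<in>{0..1}. \<not> \<phi> differentiable (at x within {0..1})} \<and>
     {x\<in>{0..1}. \<not> \<phi> differentiable (at x within {0..1})} \<subseteq> dyadic \<and>
     (\<forall>x\<in>{0..1}. \<forall>d. (\<phi> has_real_derivative d) (at x within {0..1})
        \<longrightarrow> (\<exists>k::int. d = 2 powi k))}"

definition thompson_F :: "(real \<Rightarrow> real) monoid" where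
  "thompson_F = BijGroup {0..1}\<lparr>carrier := thompson_carrier\<rparr>"


section \<open>The Hilbert space of square-integrable functions on the unit interval\<close>

abbreviation unit_measure :: "real measure" ("\<mu>") where
  "\<mu> \<equiv> restrict_space lborel {0..1}"

definition square_integrable :: "(real \<Rightarrow> complex) \<Rightarrow> bool" where
  "square_integrable f \<longleftrightarrow> f \<in> borel_measurable \<mu> \<and> integrable \<mu> (\<lambda>x. (cmod (f x))\<^sup>2)"

definition l2_rel :: "(real \<Rightarrow> complex) \<Rightarrow> (real \<Rightarrow> complex) \<Rightarrow> bool" where
  "l2_rel f g \<longleftrightarrow> square_integrable f \<and> square_integrable g \<and> (AE x in \<mu>. f x = g x)"

lemma square_integrable_zero: "square_integrable (\<lambda>_. 0)"
  by (simp add: square_integrable_def)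

lemma square_integrable_add:
  assumes "square_integrable f" "square_integrable g"
  shows "square_integrable (\<lambda>x. f x + g x)"
proof -
  have [measurable]: "f \<in> borel_measurable \<mu>" "g \<in> borel_measurable \<mu>"
    using assms by (auto simp: square_integrable_def)
  have "integrable \<mu> (\<lambda>x. (cmod (f x + g x))\<^sup>2)"
  proof (rule Bochner_Integration.integrable_bound)
    show "integrable \<mu> (\<lambda>x. 2 * (cmod (f x))\<^sup>2 + 2 * (cmod (g x))\<^sup>2)"
      using assms by (auto simp: square_integrable_def)
    have "(cmod (a + b))\<^sup>2 \<le> 2 * (cmod a)\<^sup>2 + 2 * (cmod b)\<^sup>2" for a b
    proof -
      have "(cmod (a + b))\<^sup>2 \<le> (cmod a + cmod b)\<^sup>2"
        by (intro power_mono norm_triangle_ineq) auto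
      also have "\<dots> \<le> 2 * (cmod a)\<^sup>2 + 2 * (cmod b)\<^sup>2"
        using sum_squares_bound[of "cmod a" "cmod b"] by (simp add: power2_sum)
      finally show ?thesis .
    qed
    then show "AE x in \<mu>. norm ((cmod (f x + g x))\<^sup>2)
        \<le> norm (2 * (cmod (f x))\<^sup>2 + 2 * (cmod (g x))\<^sup>2)"
      by simp
  qed measurable
  then show ?thesis by (simp add: square_integrable_def)
qed

lemma square_integrable_cmult:
  assumes "square_integrable f"
  shows "square_integrable (\<lambda>x. c * f x)"
  using assms by (auto simp: square_integrable_def norm_mult power_mult_distrib)

lemma integrable_mult_cnj:
  assumes "square_integrable f" "square_integrable g"
  shows "integrable \<mu> (\<lambda>x. f x * cnj (g x))"
proof (rule Bochner_Integration.integrable_bound)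
  have [measurable]: "f \<in> borel_measurable \<mu>" "g \<in> borel_measurable \<mu>"
    using assms by (auto simp: square_integrable_def)
  show "integrable \<mu> (\<lambda>x. (cmod (f x))\<^sup>2 + (cmod (g x))\<^sup>2)"
    using assms by (auto simp: square_integrable_def)
  have "cmod a * cmod b \<le> (cmod a)\<^sup>2 + (cmod b)\<^sup>2" for a b
    using sum_squares_bound[of "cmod a" "cmod b"] mult_nonneg_nonneg[of "cmod a" "cmod b"]
    unfolding mult.assoc by (simp del: mult_nonneg_nonneg zero_le_mult_iff)
  then show "AE x in \<mu>. norm (f x * cnj (g x)) \<le> norm ((cmod (f x))\<^sup>2 + (cmod (g x))\<^sup>2)"
    by (simp add: norm_mult)
  show "(\<lambda>x. f x * cnj (g x)) \<in> borel_measurable \<mu>"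
    using \<open>g \<in> _\<close> by (intro borel_measurable_times \<open>f \<in> _\<close>
      measurable_compose[OF \<open>g \<in> _\<close> borel_measurable_continuous_onI]) (intro continuous_intros)
qed

quotient_type l2 = "real \<Rightarrow> complex" / partial: l2_rel
proof (rule part_equivpI)
  show "\<exists>f. l2_rel f f"
    using square_integrable_zero by (auto simp: l2_rel_def)
  show "symp l2_rel"
    by (auto simp: symp_def l2_rel_def)
  show "transp l2_rel"
    by (force simp: transp_def l2_rel_def elim: AE_mp)
qed

instantiation l2 :: complex_inner
begin

lift_definition zero_l2 :: l2 is "\<lambda>_. 0"
  by (simp add: l2_rel_def square_integrable_zero)

lift_definition plus_l2 :: "l2 \<Rightarrow> l2 \<Rightarrow> l2" is "\<lambda>f g x. f x + g x"
  by (auto simp: l2_rel_def square_integrable_add)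

lift_definition scaleC_l2 :: "complex \<Rightarrow> l2 \<Rightarrow> l2" is "\<lambda>c f x. c * f x"
  by (auto simp: l2_rel_def square_integrable_cmult)

lift_definition cinner_l2 :: "l2 \<Rightarrow> l2 \<Rightarrow> complex" is "\<lambda>f g. \<integral>x. f x * cnj (g x) \<partial>\<mu>"
proof -
  fix f f' g g' assume *: "l2_rel f f'" "l2_rel g g'"
  then show "(\<integral>x. f x * cnj (g x) \<partial>\<mu>) = (\<integral>x. f' x * cnj (g' x) \<partial>\<mu>)"
    by (intro integral_cong_AE borel_measurable_integrable integrable_mult_cnj)
      (auto simp: l2_rel_def)
qed

definition uminus_l2 :: "l2 \<Rightarrow> l2" where "- x = (-1) *\<^sub>C (x::l2)"

definition minus_l2 :: "l2 \<Rightarrow> l2 \<Rightarrow> l2" where "x - y = x + - (y::l2)"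

definition scaleR_l2 :: "real \<Rightarrow> l2 \<Rightarrow> l2" where "scaleR r x = complex_of_real r *\<^sub>C (x::l2)"

definition inner_l2 :: "l2 \<Rightarrow> l2 \<Rightarrow> real" where "inner x y = Re (cinner x (y::l2))"

definition norm_l2 :: "l2 \<Rightarrow> real" where "norm x = sqrt (inner x (x::l2))"

definition sgn_l2 :: "l2 \<Rightarrow> l2" where "sgn x = scaleR (inverse (norm x)) (x::l2)"

definition dist_l2 :: "l2 \<Rightarrow> l2 \<Rightarrow> real" where "dist x y = norm (x - (y::l2))"

definition uniformity_l2 :: "(l2 \<times> l2) filter" where
  "uniformity = (INF e\<in>{0 <..}. principal {(x, y::l2). dist x y < e})"

definition open_l2 :: "l2 set \<Rightarrow> bool" where
  "open U \<longleftrightarrow> (\<forall>x::l2\<in>U. \<forall>\<^sub>F (x', y) in uniformity. x' = x \<longrightarrow> y \<in> U)"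

instance
proof
  fix x y z :: l2 and a b :: real and c d :: complex
  show "x + y + z = x + (y + z)"
    by transfer (auto simp: l2_rel_def algebra_simps square_integrable_add)
  show "x + y = y + x"
    by transfer (auto simp: l2_rel_def algebra_simps square_integrable_add)
  show "0 + x = x"
    by transfer (auto simp: l2_rel_def)
  show "- x + x = 0"
    unfolding uminus_l2_def by transfer (auto simp: l2_rel_def square_integrable_zero)
  show "x - y = x + - y"
    by (simp add: minus_l2_def)
  show scC1: "c *\<^sub>C (x + y) = c *\<^sub>C x + c *\<^sub>C y" for c and x y :: l2
    by transfer (auto simp: l2_rel_def algebra_simps square_integrable_add square_integrable_cmult)
  show scC2: "(c + d) *\<^sub>C x = c *\<^sub>C x + d *\<^sub>C x" for c d and x :: l2
    by transfer (auto simp: l2_rel_def algebra_simps square_integrable_add square_integrable_cmult)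
  show scC3: "c *\<^sub>C (d *\<^sub>C x) = (c * d) *\<^sub>C x" for c d and x :: l2
    by transfer (auto simp: l2_rel_def algebra_simps square_integrable_cmult)
  show scC4: "1 *\<^sub>C x = x" for x :: l2
    by transfer (auto simp: l2_rel_def)
  show "scaleR a x = complex_of_real a *\<^sub>C x"
    by (simp add: scaleR_l2_def)
  show "a *\<^sub>R (x + y) = a *\<^sub>R x + a *\<^sub>R y" "(a + b) *\<^sub>R x = a *\<^sub>R x + b *\<^sub>R x"
    "a *\<^sub>R b *\<^sub>R x = (a * b) *\<^sub>R x" "1 *\<^sub>R x = x"
    by (simp_all add: scaleR_l2_def scC1 scC2 scC3 scC4)
  show ccomm: "cinner x y = cnj (cinner y x)" for x y :: l2
    by transfer (subst Bochner_Integration.integral_cnj[symmetric], simp add: mult.commute)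
  show cadd: "cinner (x + y) z = cinner x z + cinner y z"
    by transfer (auto simp: l2_rel_def distrib_right integrable_mult_cnj
        intro!: Bochner_Integration.integral_add)
  show cscale: "cinner (c *\<^sub>C x) y = c * cinner x y" for c
    by transfer (simp add: mult.assoc)
  show "inner x y = Re (cinner x y)"
    by (simp add: inner_l2_def)
  show "inner x y = inner y x"
    by (subst (2) inner_l2_def, subst ccomm) (simp add: inner_l2_def)
  show "inner (x + y) z = inner x z + inner y z"
    by (simp add: inner_l2_def cadd)
  show "inner (a *\<^sub>R x) y = a * inner x y"
    by (simp add: inner_l2_def scaleR_l2_def cscale)
  have *: "(\<integral>x. f x * cnj (f x) \<partial>\<mu>) = complex_of_real (\<integral>x. (cmod (f x))\<^sup>2 \<partial>\<mu>)" for f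
    unfolding complex_norm_square[symmetric] by (rule integral_complex_of_real)
  show "0 \<le> inner x x"
    unfolding inner_l2_def by transfer (simp add: *)
  show "inner x x = 0 \<longleftrightarrow> x = 0"
    unfolding inner_l2_def
    by transfer (auto simp: * l2_rel_def square_integrable_def integral_nonneg_eq_0_iff_AE)
  show "norm x = sqrt (inner x x)" "sgn x = scaleR (inverse (norm x)) x" "dist x y = norm (x - y)"
    by (simp_all add: norm_l2_def sgn_l2_def dist_l2_def)
  show "uniformity = (INF e\<in>{0 <..}. principal {(x, y::l2). dist x y < e})"
    by (rule uniformity_l2_def)
  show "open U \<longleftrightarrow> (\<forall>x::l2\<in>U. \<forall>\<^sub>F (x', y) in uniformity. x' = x \<longrightarrow> y \<in> U)" for U :: "l2 set"
    by (rule open_l2_def)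
qed

end

lemma l2_rel_rep: "l2_rel (rep_l2 f) (rep_l2 f)"
  by (rule Quotient_rep_reflp[OF Quotient_l2])

lemma square_integrable_rep: "square_integrable (rep_l2 f)"
  using l2_rel_rep[of f] by (simp add: l2_rel_def)

lemma rep_abs_l2:
  assumes "square_integrable f"
  shows "AE x in \<mu>. rep_l2 (abs_l2 f) x = f x"
  using Quotient_rep_abs[OF Quotient_l2, of f] assms by (simp add: l2_rel_def)

lemma rep_l2_diff: "AE x in \<mu>. rep_l2 (f - g) x = rep_l2 f x - rep_l2 g x"
proof -
  have "l2_rel (rep_l2 (f - g)) (\<lambda>x. rep_l2 f x - rep_l2 g x)"
  proof -
    have "f - g = abs_l2 (\<lambda>x. rep_l2 f x + (-1) * rep_l2 g x)"
      unfolding minus_l2_def uminus_l2_def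
      by (subst (1 2) Quotient_abs_rep[OF Quotient_l2, symmetric])
        (simp add: plus_l2.abs_eq scaleC_l2.abs_eq l2_rel_rep eq_onp_def
          l2_rel_def square_integrable_rep square_integrable_cmult[of "rep_l2 g" "-1", simplified])
    then show ?thesis
      using Quotient_rep_abs[OF Quotient_l2, of "\<lambda>x. rep_l2 f x + (-1) * rep_l2 g x"]
      by (simp add: l2_rel_def square_integrable_add square_integrable_rep
          square_integrable_cmult[of "rep_l2 g" "-1", simplified])
        (use square_integrable_add[OF square_integrable_rep square_integrable_cmult[OF
            square_integrable_rep], of f "-1" g] in simp)
  qed
  then show ?thesis by (simp add: l2_rel_def)
qed

lemma norm_l2_eq: "(norm f)\<^sup>2 = (\<integral>x. (cmod (rep_l2 f x))\<^sup>2 \<partial>\<mu>)"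
proof -
  have "(norm f)\<^sup>2 = Re (cinner f f)"
    by (simp add: power2_norm_eq_inner inner_l2_def)
  also have "cinner f f = (\<integral>x. rep_l2 f x * cnj (rep_l2 f x) \<partial>\<mu>)"
    by (simp add: cinner_l2.rep_eq)
  finally show ?thesis
    unfolding complex_norm_square[symmetric]
    by (simp flip: of_real_power add: integral_complex_of_real del: of_real_power)
qed

lemma nn_integral_l2: "(\<integral>\<^sup>+x. ennreal ((cmod (rep_l2 f x))\<^sup>2) \<partial>\<mu>) = ennreal ((norm f)\<^sup>2)"
  using square_integrable_rep[of f]
  by (subst nn_integral_eq_integral) (auto simp: norm_l2_eq square_integrable_def)

lemma nn_integral_l1_le_l2: "(\<integral>\<^sup>+x. ennreal (cmod (rep_l2 f x)) \<partial>\<mu>) \<le> ennreal (norm f)"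
proof -
  have [measurable]: "rep_l2 f \<in> borel_measurable \<mu>"
    using square_integrable_rep[of f] by (simp add: square_integrable_def)
  have mass: "emeasure \<mu> {0..1} = 1"
    by (simp add: emeasure_restrict_space)
  have bound: "(\<integral>\<^sup>+x. ennreal (cmod (rep_l2 f x)) \<partial>\<mu>) \<le> ennreal (((norm f)\<^sup>2 / a + a) / 2)"
    if "a > 0" for a
  proof -
    have ineq: "t \<le> t\<^sup>2 / (2 * a) + a / 2" for t :: real
    proof -
      have "0 \<le> (t - a)\<^sup>2 / (2 * a)" using that by simp
      also have "\<dots> = t\<^sup>2 / (2 * a) + a / 2 - t"
        using that by (simp add: field_simps power2_eq_square)
      finally show ?thesis by simp
    qed
    have "(\<integral>\<^sup>+x. ennreal (cmod (rep_l2 f x)) \<partial>\<mu>)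
        \<le> (\<integral>\<^sup>+x. ennreal (1 / (2 * a)) * ennreal ((cmod (rep_l2 f x))\<^sup>2) + ennreal (a / 2) \<partial>\<mu>)"
      using that by (intro nn_integral_mono)
        (simp flip: ennreal_mult ennreal_plus del: ennreal_plus add: ineq ennreal_leI)
    also have "\<dots> = ennreal (1 / (2 * a)) * ennreal ((norm f)\<^sup>2) + ennreal (a / 2)"
      by (subst nn_integral_add) (auto simp: nn_integral_cmult nn_integral_l2 mass)
    also have "\<dots> = ennreal (((norm f)\<^sup>2 / a + a) / 2)"
      using that by (subst ennreal_mult[symmetric], simp, simp)
        (subst ennreal_plus[symmetric], simp, simp, simp add: field_simps)
    finally show ?thesis .
  qed
  show ?thesis
  proof (cases "norm f = 0")
    case True
    show ?thesis
    proof (rule ennreal_le_epsilon)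
      fix e :: real assume "0 < e"
      then show "(\<integral>\<^sup>+x. ennreal (cmod (rep_l2 f x)) \<partial>\<mu>) \<le> ennreal (norm f) + ennreal e"
        using bound[of "2 * e"] True by simp
    qed
  next
    case False
    then show ?thesis
      using bound[of "norm f"] by (simp add: power2_eq_square)
  qed
qed

instance l2 :: complex_hilbert_space
proof
  fix X :: "nat \<Rightarrow> l2"
  assume cauchy: "Cauchy X"
  have "\<exists>r::nat\<Rightarrow>nat. strict_mono r \<and> (\<forall>n. norm (X (r (Suc n)) - X (r n)) < (1/2) ^ n)"
  proof -
    have ex: "\<exists>N. \<forall>m\<ge>N. \<forall>n\<ge>N. norm (X m - X n) < (1/2) ^ k" for k :: nat
      using CauchyD[OF cauchy, of "(1/2) ^ k"] by simp
    then obtain N where N: "norm (X m - X n) < (1/2) ^ k" if "m \<ge> N k" "n \<ge> N k" for k m n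
      by metis
    define r where "r = rec_nat (N 0) (\<lambda>k q. Suc (q + N (Suc k)))"
    have r: "r (Suc k) > r k" "r k \<ge> N k" for k
      by (simp add: r_def) (cases k; simp add: r_def)
    then have mono: "strict_mono r" by (simp add: strict_mono_Suc_iff)
    moreover have "norm (X (r (Suc n)) - X (r n)) < (1/2) ^ n" for n
      using r(1)[of n] r(2)[of n] by (intro N) auto
    ultimately show ?thesis by blast
  qed
  then obtain r :: "nat \<Rightarrow> nat" where r: "strict_mono r"
    and step: "norm (X (r (Suc n)) - X (r n)) < (1/2) ^ n" for n
    by blast
  define F where "F n = rep_l2 (X (r n))" for n
  have F_sq: "square_integrable (F n)" for n
    by (simp add: F_def square_integrable_rep)
  then have [measurable]: "F n \<in> borel_measurable \<mu>" for n
    by (simp add: square_integrable_def)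
  have AE_F: "AE x in \<mu>. rep_l2 (X (r m) - X (r n)) x = F m x - F n x" for m n
    by (simp add: F_def rep_l2_diff)
  have L1: "(\<integral>\<^sup>+x. ennreal (cmod (F (Suc n) x - F n x)) \<partial>\<mu>) \<le> ennreal ((1/2) ^ n)" for n
  proof -
    have "(\<integral>\<^sup>+x. ennreal (cmod (F (Suc n) x - F n x)) \<partial>\<mu>)
        = (\<integral>\<^sup>+x. ennreal (cmod (rep_l2 (X (r (Suc n)) - X (r n)) x)) \<partial>\<mu>)"
      using AE_F[of "Suc n" n] by (intro nn_integral_cong_AE) auto
    also have "\<dots> \<le> ennreal ((1/2) ^ n)"
      using step[of n] by (intro order_trans[OF nn_integral_l1_le_l2] ennreal_leI) simp
    finally show ?thesis .
  qed
  have L2: "(\<integral>\<^sup>+x. ennreal ((cmod (F m x - F n x))\<^sup>2) \<partial>\<mu>) = ennreal ((norm (X (r m) - X (r n)))\<^sup>2)" for m n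
    unfolding nn_integral_l2[symmetric]
    using AE_F[of m n] by (intro nn_integral_cong_AE) auto
  have "(\<integral>\<^sup>+x. (\<Sum>n. ennreal (cmod (F (Suc n) x - F n x))) \<partial>\<mu>)
      = (\<Sum>n. \<integral>\<^sup>+x. ennreal (cmod (F (Suc n) x - F n x)) \<partial>\<mu>)"
    by (intro nn_integral_suminf) measurable
  also have "\<dots> \<le> (\<Sum>n. ennreal ((1/2) ^ n))"
    by (intro suminf_le L1) auto
  also have "\<dots> < \<infinity>"
    using summable_geometric[of "1/2 :: real"]
    by (subst suminf_ennreal_eq[OF _ summable_sums]) auto
  finally have "AE x in \<mu>. (\<Sum>n. ennreal (cmod (F (Suc n) x - F n x))) \<noteq> \<infinity>"
    by (intro nn_integral_PInf_AE) auto
  then have conv: "AE x in \<mu>. convergent (\<lambda>n. F n x)"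
  proof eventually_elim
    case (elim x)
    then have "summable (\<lambda>n. cmod (F (Suc n) x - F n x))"
      by (intro summable_suminf_not_top) auto
    then have "summable (\<lambda>n. F (Suc n) x - F n x)"
      by (rule summable_norm_cancel)
    then have "convergent (\<lambda>n. (\<Sum>k<n. F (Suc k) x - F k x))"
      by (simp add: summable_iff_convergent)
    then have "convergent (\<lambda>n. F n x - F 0 x)"
      by (simp only: sum_lessThan_telescope[of "\<lambda>n. F n x"])
    then have "convergent (\<lambda>n. (F n x - F 0 x) + F 0 x)"
      by (intro convergent_add convergent_const)
    then show "convergent (\<lambda>n. F n x)" by simp
  qed
  define f where "f x = lim (\<lambda>n. F n x)" for x
  have [measurable]: "f \<in> borel_measurable \<mu>"
    unfolding f_def by measurable
  have F_lim: "AE x in \<mu>. (\<lambda>n. F n x) \<longlonglongrightarrow> f x"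
    using conv by eventually_elim (simp add: f_def convergent_LIMSEQ_iff)
  have tail: "(\<integral>\<^sup>+x. ennreal ((cmod (f x - F n x))\<^sup>2) \<partial>\<mu>) \<le> ennreal (e\<^sup>2)"
    if "e > 0" "\<And>m. m \<ge> n \<Longrightarrow> norm (X (r m) - X (r n)) \<le> e" for n e
  proof -
    have "(\<integral>\<^sup>+x. ennreal ((cmod (f x - F n x))\<^sup>2) \<partial>\<mu>)
        = (\<integral>\<^sup>+x. liminf (\<lambda>m. ennreal ((cmod (F m x - F n x))\<^sup>2)) \<partial>\<mu>)"
    proof (rule nn_integral_cong_AE)
      show "AE x in \<mu>. ennreal ((cmod (f x - F n x))\<^sup>2)
          = liminf (\<lambda>m. ennreal ((cmod (F m x - F n x))\<^sup>2))"
        using F_lim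
        by eventually_elim
          (intro lim_imp_Liminf[symmetric] tendsto_ennrealI tendsto_intros; simp)
    qed
    also have "\<dots> \<le> liminf (\<lambda>m. \<integral>\<^sup>+x. ennreal ((cmod (F m x - F n x))\<^sup>2) \<partial>\<mu>)"
      by (intro nn_integral_liminf) measurable
    also have "\<dots> \<le> limsup (\<lambda>m. \<integral>\<^sup>+x. ennreal ((cmod (F m x - F n x))\<^sup>2) \<partial>\<mu>)"
      by (intro Liminf_le_Limsup) simp
    also have "\<dots> \<le> ennreal (e\<^sup>2)"
      using that unfolding L2
      by (intro Limsup_bounded eventually_sequentiallyI[of n] ennreal_leI power_mono) auto
    finally show ?thesis .
  qed
  have close: "\<exists>N. \<forall>n\<ge>N. \<forall>m\<ge>n. norm (X (r m) - X (r n)) \<le> e" if "e > 0" for e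
  proof -
    from CauchyD[OF cauchy that] obtain M
      where "\<forall>m\<ge>M. \<forall>n\<ge>M. norm (X m - X n) < e" by blast
    then have "norm (X (r m) - X (r n)) < e" if "n \<ge> M" "m \<ge> n" for m n
      using that seq_suble[OF r, of m] seq_suble[OF r, of n] by auto
    then show ?thesis by (auto intro!: exI[of _ M] less_imp_le)
  qed
  have f_sq: "square_integrable f"
  proof -
    obtain N where "\<forall>n\<ge>N. \<forall>m\<ge>n. norm (X (r m) - X (r n)) \<le> 1"
      using close[of 1] by auto
    then have "(\<integral>\<^sup>+x. ennreal ((cmod (f x - F N x))\<^sup>2) \<partial>\<mu>) \<le> ennreal (1\<^sup>2)"
      by (intro tail) auto
    then have "integrable \<mu> (\<lambda>x. (cmod (f x - F N x))\<^sup>2)"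
      by (intro integrableI_bounded) (auto simp: ennreal_one_less_top intro: le_less_trans)
    then have "square_integrable (\<lambda>x. f x - F N x)"
      by (simp add: square_integrable_def)
    from square_integrable_add[OF this F_sq[of N]] show ?thesis by simp
  qed
  have lim: "(\<lambda>n. X (r n)) \<longlonglongrightarrow> abs_l2 f"
  proof (rule LIMSEQ_I)
    fix e :: real assume "e > 0"
    then obtain N where N: "\<forall>n\<ge>N. \<forall>m\<ge>n. norm (X (r m) - X (r n)) \<le> e / 2"
      using close[of "e / 2"] by auto
    show "\<exists>N. \<forall>n\<ge>N. norm (X (r n) - abs_l2 f) < e"
    proof (intro exI[of _ N] allI impI)
      fix n assume "N \<le> n"
      have "ennreal ((norm (abs_l2 f - X (r n)))\<^sup>2) = (\<integral>\<^sup>+x. ennreal ((cmod (f x - F n x))\<^sup>2) \<partial>\<mu>)"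
        unfolding nn_integral_l2[symmetric] F_def
        using rep_l2_diff[of "abs_l2 f" "X (r n)"] rep_abs_l2[OF f_sq]
        by (intro nn_integral_cong_AE) auto
      also have "\<dots> \<le> ennreal ((e / 2)\<^sup>2)"
        using N \<open>e > 0\<close> \<open>N \<le> n\<close> by (intro tail) auto
      finally have "(norm (abs_l2 f - X (r n)))\<^sup>2 \<le> (e / 2)\<^sup>2"
        by (subst (asm) ennreal_le_iff) auto
      then have "norm (abs_l2 f - X (r n)) \<le> e / 2"
        using \<open>e > 0\<close> by (elim power2_le_imp_le) auto
      then show "norm (X (r n) - abs_l2 f) < e"
        using \<open>e > 0\<close> by (simp add: norm_minus_commute)
    qed
  qed
  have "X \<longlonglongrightarrow> abs_l2 f"
  proof (rule LIMSEQ_I)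
    fix e :: real assume "e > 0"
    then obtain M where M: "\<forall>m\<ge>M. \<forall>n\<ge>M. norm (X m - X n) < e / 2"
      using CauchyD[OF cauchy, of "e / 2"] by auto
    obtain N where N: "\<forall>n\<ge>N. norm (X (r n) - abs_l2 f) < e / 2"
      using LIMSEQ_D[OF lim, of "e / 2"] \<open>e > 0\<close> by auto
    show "\<exists>N. \<forall>n\<ge>N. norm (X n - abs_l2 f) < e"
    proof (intro exI[of _ "max M N"] allI impI)
      fix n assume n: "max M N \<le> n"
      have "norm (X n - abs_l2 f) \<le> norm (X n - X (r n)) + norm (X (r n) - abs_l2 f)"
        using norm_triangle_ineq[of "X n - X (r n)" "X (r n) - abs_l2 f"] by simp
      moreover have "norm (X n - X (r n)) < e / 2"
        using M n seq_suble[OF r, of n] by auto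
      moreover have "norm (X (r n) - abs_l2 f) < e / 2"
        using N n by auto
      ultimately show "norm (X n - abs_l2 f) < e" by linarith
    qed
  qed
  then show "convergent X" by (auto simp: convergent_def)
qed


section \<open>The representations\<close>

text \<open>
  For \<open>\<gamma>\<close> in Thompson's group the function below is square-integrable and its class does not
  depend on the representatives of \<open>f\<close> and of the Radon-Nikodym derivative, because \<open>\<gamma>\<close>
  preserves the null sets. The derivative is extended-real-valued, but finite and positive almost
  everywhere, so \<^const>\<open>powr\<close> is the usual complex power of a positive real number.
\<close>

definition koopman_rep :: "real \<Rightarrow> (real \<Rightarrow> real) \<Rightarrow> l2 \<Rightarrow> l2" where
  "koopman_rep s \<gamma> f = abs_l2 (\<lambda>x.
     complex_of_real (enn2real (RN_deriv \<mu> (distr \<mu> \<mu> \<gamma>) x)) powr (1 / 2 + \<i> * complex_of_real s)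
       * rep_l2 f (inv_into {0..1} \<gamma> x))"

end

theory Submission
  imports Defs
begin

text \<open>
  Elements of the group supported on \<open>[0, c]\<close>, \<open>c\<close> dyadic, that push almost all of \<open>[0, c]\<close> into a small
  neighbourhood of 0 converge weakly, under \<open>\<pi>\<^sub>s\<close>, to the multiplication by the indicator of \<open>(c, 1]\<close>.
  Hence if \<open>w\<close> is orthogonal to the orbit of \<open>u\<close>, then so it is to every product of an indicator of
  \<open>(c, 1]\<close> with an element of the orbit, which means that \<open>\<pi>\<^sub>s(\<gamma>) u \<cdot> cnj w\<close> vanishes almost everywhere for all
  \<open>\<gamma>\<close>. Since the group contains the translation by any dyadic number on any interval on which this makes
  sense in the interior of \<open>[0, 1]\<close>, and dyadic translations act ergodically, \<open>u\<close> or \<open>w\<close> is 0.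
\<close>

section \<open>Thompson's group as a group of dyadic piecewise linear maps\<close>

text \<open>The weak limit comes from cutting a vector into its parts over (c, 1], [0, c - e] and (c
  - e, c]. The first part is fixed, the second is carried into [0, e], where \<open>w\<close> has
  little mass, and the third has small norm. Cauchy-Schwarz and unitarity bound both error terms, so
  no formula for the Radon-Nikodym derivative is ever computed, and \<open>s\<close> only enters
  through a phase that is never examined. Nor must the squeezing elements be known pointwise on
  [0, c]: it is enough that they are increasing and send c - e to e. One family of four-piece maps
  serves twice: as the squeezing elements, and, with c = 1 and a small step, as the translations in
  the interior. The obstacle on the group side is that the carrier is described through
  differentiability, which is awkward under composition and inversion. \<open>dyadic_pl\<close>
  replaces it by a finite set of break points, possibly larger than necessary, and a slope on each
  gap.\<close>

definition dyadic_pl :: "real set \<Rightarrow> (real \<Rightarrow> real) \<Rightarrow> bool" where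
  "dyadic_pl P \<phi> \<longleftrightarrow> finite P \<and>
     (\<forall>u v. 0 \<le> u \<and> u < v \<and> v \<le> 1 \<and> P \<inter> {u<..<v} = {}
        \<longrightarrow> (\<exists>(k::int) c. \<forall>t\<in>{u..v}. \<phi> t = 2 powi k * t + c))"

lemma dyadic_plD:
  assumes "dyadic_pl P \<phi>" "0 \<le> u" "u < v" "v \<le> 1" "P \<inter> {u<..<v} = {}"
  obtains k :: int and c where "\<And>t. t \<in> {u..v} \<Longrightarrow> \<phi> t = 2 powi k * t + c"
  using assms unfolding dyadic_pl_def by meson

lemma affine_has_derivative_within:
  fixes m c :: real
  assumes "\<And>t. t \<in> S \<Longrightarrow> \<phi> t = m * t + c" "x \<in> S"
  shows "(\<phi> has_real_derivative m) (at x within S)"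
proof (rule has_field_derivative_transform_within[where d = 1])
  show "((\<lambda>t. m * t + c) has_real_derivative m) (at x within S)"
    by (auto intro!: derivative_eq_intros)
qed (use assms in auto)

text \<open>A derivative within \<open>S\<close> restricts to the nondegenerate interval [u, v],
  where derivatives are unique, also the one-sided ones at the ends. So a slope can be read off from
  one side of a break point.\<close>

lemma derivative_eq_slope:
  fixes m c :: real
  assumes d: "(\<phi> has_real_derivative d) (at x within S)"
    and uv: "u < v" "{u..v} \<subseteq> S" "x \<in> {u..v}"
    and aff: "\<And>t. t \<in> {u..v} \<Longrightarrow> \<phi> t = m * t + c"
  shows "d = m"
proof -
  have "(\<phi> has_vector_derivative m) (at x within cbox u v)"
    using affine_has_derivative_within[OF aff \<open>x \<in> {u..v}\<close>]
    by (simp add: has_real_derivative_iff_has_vector_derivative)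
  moreover have "(\<phi> has_vector_derivative d) (at x within cbox u v)"
    using DERIV_subset[OF d uv(2)] by (simp add: has_real_derivative_iff_has_vector_derivative)
  ultimately show ?thesis
    using vector_derivative_unique_within_closed_interval[of u v x \<phi> m d] uv by auto
qed

text \<open>Outside \<open>P\<close> the gap is a relative neighbourhood of \<open>x\<close>, so
  differentiability can be tested on it. At a point of \<open>P\<close> only one side is available,
  which still identifies a derivative that is known to exist.\<close>

lemma gap_around:
  fixes x :: real
  assumes "finite P" "x \<in> {0..1}"
  obtains u v where "0 \<le> u" "u < v" "v \<le> 1" "x \<in> {u..v}" "P \<inter> {u<..<v} = {}"
    "x \<notin> P \<Longrightarrow> \<exists>e>0. {x-e<..<x+e} \<inter> {0..1} \<subseteq> {u..v}"
proof -
  have "closed (P - {x})" using assms by (intro finite_imp_closed) auto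
  then have "open (- (P - {x}))" by (rule open_Compl)
  moreover have "x \<in> - (P - {x})" by simp
  ultimately obtain e where e: "e > 0" "ball x e \<subseteq> - (P - {x})"
    using open_contains_ball by blast
  have not: "y \<notin> P" if "\<bar>y - x\<bar> < e" "y \<noteq> x" for y
    using e(2) that by (auto simp: ball_def dist_real_def abs_minus_commute)
  show thesis
  proof (cases "x \<in> P")
    case False
    show thesis
    proof (rule that[of "max 0 (x - e)" "min 1 (x + e)"])
      show "P \<inter> {max 0 (x - e)<..<min 1 (x + e)} = {}"
        using not False by (force simp: abs_less_iff)
      show "\<exists>ea>0. {x - ea<..<x + ea} \<inter> {0..1} \<subseteq> {max 0 (x - e)..min 1 (x + e)}"
        using e(1) by (intro exI[of _ e]) auto
    qed (use assms e in auto)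
  next
    case True
    show thesis
    \<comment> \<open>At a break point the gap to its right is taken; only x = 1 needs the one to
      its left.\<close>
    proof (cases "x < 1")
      case lt: True
      show thesis
      proof (rule that[of x "min 1 (x + e)"])
        show "P \<inter> {x<..<min 1 (x + e)} = {}"
          using not by (force simp: abs_less_iff)
      qed (use assms e lt True in auto)
    next
      case False
      show thesis
      proof (rule that[of "max 0 (x - e)" x])
        show "P \<inter> {max 0 (x - e)<..<x} = {}"
          using not by (force simp: abs_less_iff)
      qed (use assms e True False in auto)
    qed
  qed
qed

lemma dyadic_pl_differentiable:
  assumes "dyadic_pl P \<phi>" "x \<in> {0..1} - P"
  shows "\<phi> differentiable (at x within {0..1})"
proof -
  obtain u v where uv: "0 \<le> u" "u < v" "v \<le> 1" "x \<in> {u..v}" "P \<inter> {u<..<v} = {}"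
    and e: "\<exists>e>0. {x-e<..<x+e} \<inter> {0..1} \<subseteq> {u..v}"
    using gap_around[of P x] assms by (auto simp: dyadic_pl_def)
  from dyadic_plD[OF assms(1) uv(1-3,5)] obtain k c where
    kc: "\<And>t. t \<in> {u..v} \<Longrightarrow> \<phi> t = 2 powi k * t + c" by blast
  from e obtain e where e: "e > 0" "{x-e<..<x+e} \<inter> {0..1} \<subseteq> {u..v}" by blast
  have "(\<phi> has_real_derivative 2 powi k) (at x within {x-e<..<x+e} \<inter> {0..1})"
    using e assms(2) by (intro affine_has_derivative_within[where c = c] kc) auto
  also have "{x-e<..<x+e} \<inter> {0..1} = {0..1} \<inter> {x-e<..<x+e}" by auto
  finally have "(\<phi> has_real_derivative 2 powi k) (at x within {0..1} \<inter> {x-e<..<x+e})" .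
  then have "(\<phi> has_real_derivative 2 powi k) (at x within {0..1})"
    using e(1) by (subst at_within_nhd[of x "{x-e<..<x+e}" "{0..1}" "{0..1} \<inter> {x-e<..<x+e}"]) auto
  then show ?thesis using real_differentiable_def by blast
qed

lemma thompson_carrierI:
  assumes "\<phi> \<in> extensional {0..1}" "homeomorphism {0..1} {0..1} \<phi> \<psi>"
    "strict_mono_on {0..1} \<phi>" "\<phi> ` (dyadic \<inter> {0..1}) = dyadic \<inter> {0..1}"
    and pl: "dyadic_pl P \<phi>" and P: "P \<subseteq> dyadic"
  shows "\<phi> \<in> thompson_carrier"
proof -
  have fin: "finite P" using pl by (simp add: dyadic_pl_def)
  have sub: "{x\<in>{0..1}. \<not> \<phi> differentiable (at x within {0..1})} \<subseteq> P"
    using dyadic_pl_differentiable[OF pl] by blast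
  have "piecewise_linear \<phi>"
    unfolding piecewise_linear_def
  proof (intro exI[of _ P] conjI allI impI)
    fix u v :: real assume uv: "0 \<le> u \<and> u < v \<and> v \<le> 1 \<and> P \<inter> {u<..<v} = {}"
    then have "0 \<le> u" "u < v" "v \<le> 1" "P \<inter> {u<..<v} = {}" by auto
    from dyadic_plD[OF pl this] obtain k c where
      "\<And>t. t \<in> {u..v} \<Longrightarrow> \<phi> t = 2 powi k * t + c" by blast
    then show "\<exists>m c. \<forall>t\<in>{u..v}. \<phi> t = m * t + c" by blast
  qed (rule fin)
  moreover have "\<forall>x\<in>{0..1}. \<forall>d. (\<phi> has_real_derivative d) (at x within {0..1})
      \<longrightarrow> (\<exists>k::int. d = 2 powi k)"
  proof (intro ballI allI impI)
    fix x d assume x: "x \<in> {0..1}" and d: "(\<phi> has_real_derivative d) (at x within {0..1})"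
    obtain u v where uv: "0 \<le> u" "u < v" "v \<le> 1" "x \<in> {u..v}" "P \<inter> {u<..<v} = {}"
      by (rule gap_around[OF fin x])
    from dyadic_plD[OF pl uv(1-3,5)] obtain k c where
      kc: "\<And>t. t \<in> {u..v} \<Longrightarrow> \<phi> t = 2 powi k * t + c" by blast
    have "d = 2 powi k"
      by (rule derivative_eq_slope[OF d uv(2) _ uv(4)]) (use uv kc in auto)
    then show "\<exists>k::int. d = 2 powi k" by blast
  qed
  moreover have "\<exists>\<psi>. homeomorphism {0..1} {0..1} \<phi> \<psi>" using assms(2) by blast
  ultimately show ?thesis
    using assms(1,3,4) order_trans[OF sub P] finite_subset[OF sub fin]
    unfolding thompson_carrier_def by - (intro CollectI conjI; assumption)
qed

text \<open>The points of \<open>Q\<close> are removed from the break set one at a time. At such a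
  point the slopes on both sides equal the derivative, and the common value there makes the
  constants agree too.\<close>

lemma piecewise_linear_merge:
  assumes "finite Q"
    and diff: "\<And>x. x \<in> Q \<inter> {0<..<1} \<Longrightarrow> \<phi> differentiable (at x within {0..1})"
    and lin: "\<And>u v. 0 \<le> u \<Longrightarrow> u < v \<Longrightarrow> v \<le> 1 \<Longrightarrow> (R \<union> Q) \<inter> {u<..<v} = {}
        \<Longrightarrow> \<exists>m c. \<forall>t\<in>{u..v}. \<phi> t = m * t + (c::real)"
    and uv: "0 \<le> u" "u < v" "v \<le> 1" "R \<inter> {u<..<v} = {}"
  shows "\<exists>m c. \<forall>t\<in>{u..v}. \<phi> t = m * t + (c::real)"
  using assms
proof (induction Q arbitrary: R u v rule: finite_induct)
  case empty
  then show ?case by simp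
next
  case (insert p Q)
  have step: "\<exists>m c. \<forall>t\<in>{u..v}. \<phi> t = m * t + c"
    if "0 \<le> u" "u < v" "v \<le> 1" "insert p R \<inter> {u<..<v} = {}" for u v
    by (rule insert.IH[of "insert p R"]) (use insert.prems that in auto)
  show ?case
  proof (cases "p \<in> {u<..<v}")
    case False
    then show ?thesis using step insert.prems by auto
  next
    case True
    obtain m1 c1 where 1: "\<And>t. t \<in> {u..p} \<Longrightarrow> \<phi> t = m1 * t + c1"
      using step[of u p] insert.prems True by fastforce
    obtain m2 c2 where 2: "\<And>t. t \<in> {p..v} \<Longrightarrow> \<phi> t = m2 * t + c2"
      using step[of p v] insert.prems True by fastforce
    have "p \<in> insert p Q \<inter> {0<..<1}" using insert.prems True by auto
    then obtain d where d: "(\<phi> has_real_derivative d) (at p within {0..1})"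
      using insert.prems(1) real_differentiable_def by blast
    have "d = m1"
      by (rule derivative_eq_slope[OF d _ _ _ 1]) (use True insert.prems in auto)
    moreover have "d = m2"
      by (rule derivative_eq_slope[OF d _ _ _ 2]) (use True insert.prems in auto)
    moreover have "m1 * p + c1 = m2 * p + c2"
      using 1[of p] 2[of p] True by auto
    ultimately have "\<phi> t = m1 * t + c1" if "t \<in> {u..v}" for t
      using 1[of t] 2[of t] that True by (cases "t \<le> p") auto
    then show ?thesis by blast
  qed
qed

text \<open>The break set given by \<open>piecewise_linear\<close> need not be dyadic. Its points of
  differentiability are merged away; what remains consists of nondifferentiability points, which are
  dyadic by definition of the group.\<close>

lemma thompson_carrierE:
  assumes "\<phi> \<in> thompson_carrier"
  obtains P where "P \<subseteq> dyadic" "dyadic_pl P \<phi>"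
proof -
  define N where "N = {x\<in>{0..1}. \<not> \<phi> differentiable (at x within {0..1})}"
  have N: "finite N" "N \<subseteq> dyadic"
    using assms by (auto simp: N_def thompson_carrier_def)
  have "piecewise_linear \<phi>" using assms by (simp add: thompson_carrier_def)
  then obtain P where P: "finite P" and lin: "\<And>u v. 0 \<le> u \<Longrightarrow> u < v \<Longrightarrow> v \<le> 1 \<Longrightarrow> P \<inter> {u<..<v} = {}
        \<Longrightarrow> \<exists>m c. \<forall>t\<in>{u..v}. \<phi> t = m * t + c"
    unfolding piecewise_linear_def by meson
  have slope: "\<forall>x\<in>{0..1}. \<forall>d. (\<phi> has_real_derivative d) (at x within {0..1})
      \<longrightarrow> (\<exists>k::int. d = 2 powi k)"
    using assms by (simp add: thompson_carrier_def)
  have "dyadic_pl (P \<inter> N) \<phi>"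
    unfolding dyadic_pl_def
  proof (intro conjI allI impI)
    show "finite (P \<inter> N)" using P by simp
    fix u v :: real assume uv: "0 \<le> u \<and> u < v \<and> v \<le> 1 \<and> P \<inter> N \<inter> {u<..<v} = {}"
    have "\<exists>m c. \<forall>t\<in>{u..v}. \<phi> t = m * t + c"
    proof (rule piecewise_linear_merge[where Q = "P - N" and R = "P \<inter> N"])
      fix a b :: real
      assume "0 \<le> a" "a < b" "b \<le> 1" "(P \<inter> N \<union> (P - N)) \<inter> {a<..<b} = {}"
      then show "\<exists>m c. \<forall>t\<in>{a..b}. \<phi> t = m * t + c"
        by (intro lin) auto
    qed (use P uv in \<open>auto simp: N_def\<close>)
    then obtain m c where mc: "\<And>t. t \<in> {u..v} \<Longrightarrow> \<phi> t = m * t + c" by blast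
    \<comment> \<open>The slope is a power of 2 because it is the derivative at the midpoint, an
      interior point of the gap.\<close>
    have "((\<phi> has_real_derivative m) (at ((u + v) / 2) within {u<..<v}))"
      by (rule affine_has_derivative_within[where c = c]) (use mc uv in auto)
    then have "(\<phi> has_real_derivative m) (at ((u + v) / 2))"
      by (subst (asm) at_within_open) (use uv in auto)
    then have "(\<phi> has_real_derivative m) (at ((u + v) / 2) within {0..1})"
      by (rule has_field_derivative_at_within)
    moreover have "(u + v) / 2 \<in> {0..1}" using uv by auto
    ultimately obtain k :: int where "m = 2 powi k"
      using slope by blast
    with mc show "\<exists>(k::int) c. \<forall>t\<in>{u..v}. \<phi> t = 2 powi k * t + c" by blast
  qed
  then show thesis using that[of "P \<inter> N"] N by blast
qed

section \<open>Closure under composition and inversion\<close>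

lemma thompson_carrier_bij_betw:
  assumes "\<phi> \<in> thompson_carrier"
  shows "bij_betw \<phi> {0..1} {0..1}"
proof -
  obtain \<psi> where "homeomorphism {0..1} {0..1} \<phi> \<psi>"
    using assms by (auto simp: thompson_carrier_def)
  then show ?thesis
    by (intro bij_betw_byWitness[where f' = \<psi>]) (auto simp: homeomorphism_def)
qed

lemma thompson_carrier_continuous:
  assumes "\<phi> \<in> thompson_carrier"
  shows "continuous_on {0..1} \<phi>"
  using assms by (auto simp: thompson_carrier_def homeomorphism_def)

lemma thompson_carrier_strict_mono: "g \<in> thompson_carrier \<Longrightarrow> strict_mono_on {0..1} g"
  unfolding thompson_carrier_def by blast

lemma thompson_carrier_subset_Bij: "thompson_carrier \<subseteq> Bij {0..1}"
  using thompson_carrier_bij_betw by (auto simp: Bij_def thompson_carrier_def)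

lemma thompson_carrier_compose:
  assumes g: "g \<in> thompson_carrier" and f: "f \<in> thompson_carrier"
  shows "compose {0..1} g f \<in> thompson_carrier"
proof -
  obtain P where P: "P \<subseteq> dyadic" "dyadic_pl P f" by (rule thompson_carrierE[OF f])
  obtain Q where Q: "Q \<subseteq> dyadic" "dyadic_pl Q g" by (rule thompson_carrierE[OF g])
  obtain f' where f': "homeomorphism {0..1} {0..1} f f'"
    using f by (auto simp: thompson_carrier_def)
  obtain g' where g': "homeomorphism {0..1} {0..1} g g'"
    using g by (auto simp: thompson_carrier_def)
  have mono: "strict_mono_on {0..1} f" "strict_mono_on {0..1} g"
    using f g by (auto simp: thompson_carrier_def)
  have maps: "f x \<in> {0..1}" if "x \<in> {0..1}" for x
    using bij_betwE[OF thompson_carrier_bij_betw[OF f]] that by blast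
  have dya: "f ` (dyadic \<inter> {0..1}) = dyadic \<inter> {0..1}" "g ` (dyadic \<inter> {0..1}) = dyadic \<inter> {0..1}"
    using f g by (auto simp: thompson_carrier_def)
  have eq: "compose {0..1} g f x = g (f x)" if "x \<in> {0..1}" for x
    using that by (simp add: compose_def)
  \<comment> \<open>The composite can break only at a break of \<open>f\<close> or at a point that
    \<open>f\<close> sends to a break of \<open>g\<close>. The latter are dyadic because
    \<open>f\<close> maps the dyadics of the interval onto themselves.\<close>
  let ?R = "P \<union> f' ` (Q \<inter> {0..1})"
  show ?thesis
  proof (rule thompson_carrierI)
    show "compose {0..1} g f \<in> extensional {0..1}" by simp
    show "homeomorphism {0..1} {0..1} (compose {0..1} g f) (f' \<circ> g')"
      by (rule homeomorphism_cong[OF homeomorphism_compose[OF f' g']]) (auto simp: eq)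
    show "strict_mono_on {0..1} (compose {0..1} g f)"
      using mono maps by (auto simp: strict_mono_on_def eq)
    have "compose {0..1} g f ` (dyadic \<inter> {0..1}) = g ` f ` (dyadic \<inter> {0..1})"
      by (auto simp: eq image_iff)
    then show "compose {0..1} g f ` (dyadic \<inter> {0..1}) = dyadic \<inter> {0..1}"
      by (simp only: dya)
    have "f' y \<in> dyadic" if y: "y \<in> Q \<inter> {0..1}" for y
    proof -
      obtain x where "x \<in> dyadic \<inter> {0..1}" "f x = y"
        using dya(1) Q(1) y by (metis (no_types, lifting) IntE IntI image_iff subsetD)
      then show ?thesis using f' by (auto simp: homeomorphism_def)
    qed
    then show "?R \<subseteq> dyadic" using P by blast
    show "dyadic_pl ?R (compose {0..1} g f)"
      unfolding dyadic_pl_def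
    proof (intro conjI allI impI)
      show "finite ?R" using P(2) Q(2) by (auto simp: dyadic_pl_def)
      fix u v :: real assume uv: "0 \<le> u \<and> u < v \<and> v \<le> 1 \<and> ?R \<inter> {u<..<v} = {}"
      then have "0 \<le> u" "u < v" "v \<le> 1" "P \<inter> {u<..<v} = {}" by auto
      from dyadic_plD[OF P(2) this] obtain k c where
        kc: "\<And>t. t \<in> {u..v} \<Longrightarrow> f t = 2 powi k * t + c" by blast
      have fuv: "0 \<le> f u" "f u < f v" "f v \<le> 1"
        using uv maps[of u] maps[of v] mono(1) by (auto simp: strict_mono_on_def)
      have "Q \<inter> {f u<..<f v} = {}"
      proof (rule ccontr)
        assume "Q \<inter> {f u<..<f v} \<noteq> {}"
        then obtain q where q: "q \<in> Q" "f u < q" "q < f v" by auto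
        then have q01: "q \<in> {0..1}" using fuv by auto
        have "f (f' q) = q" "f' q \<in> {0..1}" using f' q01 by (auto simp: homeomorphism_def)
        then have "f' q \<in> {u<..<v}"
          using q uv mono(1) strict_mono_on_less[OF mono(1), of u "f' q"]
            strict_mono_on_less[OF mono(1), of "f' q" v] by auto
        then show False using uv q q01 by blast
      qed
      from dyadic_plD[OF Q(2) fuv this] obtain l d where
        ld: "\<And>t. t \<in> {f u..f v} \<Longrightarrow> g t = 2 powi l * t + d" by blast
      have "compose {0..1} g f t = 2 powi (l + k) * t + (2 powi l * c + d)" if t: "t \<in> {u..v}" for t
      proof -
        have "f t \<in> {f u..f v}"
          using t uv strict_mono_on_leD[OF mono(1), of u t] strict_mono_on_leD[OF mono(1), of t v]
          by auto
        then have "g (f t) = 2 powi l * (2 powi k * t + c) + d"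
          using ld[of "f t"] kc[OF t] by simp
        then show ?thesis using t uv by (simp add: eq power_int_add algebra_simps)
      qed
      then show "\<exists>(k::int) c. \<forall>t\<in>{u..v}. compose {0..1} g f t = 2 powi k * t + c"
        by blast
    qed
  qed
qed

lemma thompson_carrier_inverse:
  assumes f: "f \<in> thompson_carrier"
  shows "restrict (inv_into {0..1} f) {0..1} \<in> thompson_carrier"
proof -
  obtain P where P: "P \<subseteq> dyadic" "dyadic_pl P f" by (rule thompson_carrierE[OF f])
  obtain f' where f': "homeomorphism {0..1} {0..1} f f'"
    using f by (auto simp: thompson_carrier_def)
  have mono: "strict_mono_on {0..1} f"
    using f by (auto simp: thompson_carrier_def)
  have bij: "bij_betw f {0..1} {0..1}" by (rule thompson_carrier_bij_betw[OF f])
  have dya: "f ` (dyadic \<inter> {0..1}) = dyadic \<inter> {0..1}"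
    using f by (auto simp: thompson_carrier_def)
  let ?i = "restrict (inv_into {0..1} f) {0..1}"
  have ff: "f (f' y) = y" "f' y \<in> {0..1}" if "y \<in> {0..1}" for y
    using f' that by (auto simp: homeomorphism_def)
  have ff': "f' (f y) = y" "f y \<in> {0..1}" if "y \<in> {0..1}" for y
    using f' that by (auto simp: homeomorphism_def)
  have eq: "inv_into {0..1} f y = f' y" if "y \<in> {0..1}" for y
    by (rule inv_into_f_eq) (use that bij ff in \<open>simp_all add: bij_betw_def\<close>)
  have less: "f' x < f' y" if "x \<in> {0..1}" "y \<in> {0..1}" "x < y" for x y
    using that ff[of x] ff[of y] strict_mono_on_less[OF mono, of "f' x" "f' y"] by simp
  show ?thesis
  proof (rule thompson_carrierI)
    show "?i \<in> extensional {0..1}" by simp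
    show "homeomorphism {0..1} {0..1} ?i f"
      by (rule homeomorphism_cong[OF homeomorphism_symD[OF f']]) (auto simp: eq)
    show "strict_mono_on {0..1} ?i"
      using less by (auto simp: strict_mono_on_def eq)
    have "?i ` (dyadic \<inter> {0..1}) = f' ` (dyadic \<inter> {0..1})"
      by (rule image_cong) (auto simp: eq)
    also have "\<dots> = f' ` f ` (dyadic \<inter> {0..1})" by (simp only: dya)
    also have "\<dots> = dyadic \<inter> {0..1}" using ff' by (force simp: image_iff)
    finally show "?i ` (dyadic \<inter> {0..1}) = dyadic \<inter> {0..1}" .
    \<comment> \<open>The inverse breaks only at images of breaks of \<open>f\<close>, and its
      slopes are the reciprocals.\<close>
    show "f ` (P \<inter> {0..1}) \<subseteq> dyadic" using dya P(1) by blast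
    show "dyadic_pl (f ` (P \<inter> {0..1})) ?i"
      unfolding dyadic_pl_def
    proof (intro conjI allI impI)
      show "finite (f ` (P \<inter> {0..1}))" using P(2) by (auto simp: dyadic_pl_def)
      fix u v :: real assume uv: "0 \<le> u \<and> u < v \<and> v \<le> 1 \<and> f ` (P \<inter> {0..1}) \<inter> {u<..<v} = {}"
      have f'uv: "0 \<le> f' u" "f' u < f' v" "f' v \<le> 1"
        using uv less[of u v] ff[of u] ff[of v] by auto
      have "P \<inter> {f' u<..<f' v} = {}"
      proof (rule ccontr)
        assume "P \<inter> {f' u<..<f' v} \<noteq> {}"
        then obtain q where q: "q \<in> P" "f' u < q" "q < f' v" by auto
        then have q01: "q \<in> {0..1}" using f'uv by auto
        have "u < f q" "f q < v"
          using strict_mono_on_less[OF mono, of "f' u" q] strict_mono_on_less[OF mono, of q "f' v"]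
            q q01 ff[of u] ff[of v] uv by auto
        then have "f q \<in> f ` (P \<inter> {0..1}) \<inter> {u<..<v}" using q q01 by auto
        then show False using uv by blast
      qed
      from dyadic_plD[OF P(2) f'uv this] obtain k c where
        kc: "\<And>t. t \<in> {f' u..f' v} \<Longrightarrow> f t = 2 powi k * t + c" by blast
      have "?i t = 2 powi (-k) * t + (- c * 2 powi (-k))" if t: "t \<in> {u..v}" for t
      proof -
        have t01: "t \<in> {0..1}" using t uv by auto
        have "f' t \<in> {f' u..f' v}"
          using t uv less[of u t] less[of t v] by (auto simp: less_le)
        then have "t = 2 powi k * f' t + c"
          using kc[of "f' t"] ff(1)[OF t01] by simp
        then have "t - c = 2 powi k * f' t" by simp
        then have "2 powi (-k) * (t - c) = 2 powi (-k) * (2 powi k * f' t)"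
          by (rule arg_cong)
        then show ?thesis using t01 by (simp add: eq power_int_minus field_simps)
      qed
      then show "\<exists>(k::int) c. \<forall>t\<in>{u..v}. ?i t = 2 powi k * t + c"
        by blast
    qed
  qed
qed

lemma thompson_carrier_id: "(\<lambda>x\<in>{0..1}. x) \<in> thompson_carrier"
proof (rule thompson_carrierI)
  show "homeomorphism {0..1} {0..1} (\<lambda>x\<in>{0..1}. x) (\<lambda>x::real. x)"
    by (rule homeomorphism_cong[OF homeomorphism_ident]) auto
  show "strict_mono_on {0..1} (\<lambda>x\<in>{0..1}. x :: real)"
    by (simp add: strict_mono_on_def)
  show "dyadic_pl {} (\<lambda>x\<in>{0..1}. x)"
    unfolding dyadic_pl_def
    by (auto intro!: exI[of _ "0 :: int"] exI[of _ "0 :: real"])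
qed (auto simp: image_iff)

lemma group_thompson_F: "group thompson_F"
proof -
  have "subgroup thompson_carrier (BijGroup {0..1})"
  proof (rule subgroup.intro)
    show "thompson_carrier \<subseteq> carrier (BijGroup {0..1})"
      using thompson_carrier_subset_Bij by (simp add: BijGroup_def)
    show "x \<otimes>\<^bsub>BijGroup {0..1}\<^esub> y \<in> thompson_carrier"
      if "x \<in> thompson_carrier" "y \<in> thompson_carrier" for x y
      using that thompson_carrier_compose thompson_carrier_subset_Bij by (auto simp: BijGroup_def)
    show "\<one>\<^bsub>BijGroup {0..1}\<^esub> \<in> thompson_carrier"
      using thompson_carrier_id by (simp add: BijGroup_def)
    show "inv\<^bsub>BijGroup {0..1}\<^esub> x \<in> thompson_carrier" if "x \<in> thompson_carrier" for x
      using that thompson_carrier_inverse thompson_carrier_subset_Bij by (simp add: inv_BijGroup subsetD)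
  qed
  then show ?thesis
    unfolding thompson_F_def by (rule group.subgroup_imp_group[OF group_BijGroup])
qed

lemma mult_thompson_F:
  "g \<in> thompson_carrier \<Longrightarrow> h \<in> thompson_carrier \<Longrightarrow> g \<otimes>\<^bsub>thompson_F\<^esub> h = compose {0..1} g h"
  using thompson_carrier_subset_Bij by (auto simp: thompson_F_def BijGroup_def)

lemma carrier_thompson_F: "carrier thompson_F = thompson_carrier"
  by (simp add: thompson_F_def)


section \<open>Squeezing elements\<close>

lemma dyadic_add: "x \<in> dyadic \<Longrightarrow> y \<in> dyadic \<Longrightarrow> x + y \<in> dyadic"
proof -
  assume "x \<in> dyadic" "y \<in> dyadic"
  then obtain a n b m where "x = of_int a / 2 ^ n" "y = of_int b / 2 ^ m"
    by (auto simp: dyadic_def)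
  then have "x + y = of_int (a * 2 ^ m + b * 2 ^ n) / 2 ^ (n + m)"
    by (simp add: add_divide_distrib power_add)
  then show ?thesis unfolding dyadic_def by blast
qed

lemma dyadic_of_int: "of_int a / 2 ^ n \<in> dyadic"
  unfolding dyadic_def by blast

lemma dyadic_minus: "x \<in> dyadic \<Longrightarrow> - x \<in> dyadic"
proof -
  assume "x \<in> dyadic"
  then obtain a n where "x = of_int a / 2 ^ n" by (auto simp: dyadic_def)
  then have "- x = of_int (- a) / 2 ^ n" by simp
  then show ?thesis unfolding dyadic_def by blast
qed

lemma dyadic_diff: "x \<in> dyadic \<Longrightarrow> y \<in> dyadic \<Longrightarrow> x - y \<in> dyadic"
  using dyadic_add[of x "- y"] dyadic_minus[of y] by simp

lemma dyadic_double: "x \<in> dyadic \<Longrightarrow> 2 * x \<in> dyadic"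
  using dyadic_add[of x x] by simp

lemma dyadic_half: "x \<in> dyadic \<Longrightarrow> x / 2 \<in> dyadic"
proof -
  assume "x \<in> dyadic"
  then obtain a n where "x = of_int a / 2 ^ n" by (auto simp: dyadic_def)
  then have "x / 2 = of_int a / 2 ^ Suc n" by simp
  then show ?thesis unfolding dyadic_def by blast
qed

lemma countable_dyadic: "countable dyadic"
proof -
  have "dyadic = (\<lambda>(a, n). of_int a / 2 ^ n) ` (UNIV :: (int \<times> nat) set)"
    by (auto simp: dyadic_def)
  then show ?thesis by (metis countable_image countableI_type)
qed

text \<open>When 3 * h <= c, the branches x / 2, x - h, 2 * x - c and x hold in turn, with breaks at
  2 * h, c - h and c. For h = 1/4 and c = 1 this is a standard generator of the group. The min-max
  form gives continuity and monotonicity at once. With h = c / 4 the iterates squeeze [0, c] towards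
  0; with c = 1 and small h the map is the translation by -h away from the end points.\<close>

definition squeeze :: "real \<Rightarrow> real \<Rightarrow> real \<Rightarrow> real" where
  "squeeze h c = (\<lambda>x\<in>{0..1}. min x (max (x / 2) (max (x - h) (2 * x - c))))"

lemma squeeze_mem: "x \<in> {0..1} \<Longrightarrow> 0 < h \<Longrightarrow> squeeze h c x \<in> {0..1}"
  by (auto simp: squeeze_def)

lemma squeeze_eq:
  assumes "0 < h" "3 * h \<le> c" "c \<le> 1" "x \<in> {0..1}"
  shows "x \<le> 2 * h \<Longrightarrow> squeeze h c x = x / 2"
    and "2 * h \<le> x \<Longrightarrow> x \<le> c - h \<Longrightarrow> squeeze h c x = x - h"
    and "c - h \<le> x \<Longrightarrow> x \<le> c \<Longrightarrow> squeeze h c x = 2 * x - c"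
    and "c \<le> x \<Longrightarrow> squeeze h c x = x"
  using assms by (auto simp: squeeze_def min_def max_def)

lemma squeeze_in_thompson_carrier:
  assumes hc: "0 < h" "3 * h \<le> c" "c \<le> 1" and dy: "h \<in> dyadic" "c \<in> dyadic"
  shows "squeeze h c \<in> thompson_carrier"
proof -
  have sq: "squeeze h c x = min x (max (x / 2) (max (x - h) (2 * x - c)))" if "x \<in> {0..1}" for x
    using that by (simp add: squeeze_def)
  have cont: "continuous_on {0..1} (squeeze h c)"
    by (subst continuous_on_cong[OF refl sq]) (auto intro!: continuous_intros)
  have mono: "strict_mono_on {0..1} (squeeze h c)"
    by (auto simp: strict_mono_on_def sq min_def max_def)
  \<comment> \<open>The disjunction records how the preimage is computed from \<open>y\<close>; this
    is what later makes the preimage of a dyadic point dyadic.\<close>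
  have surj: "\<exists>x\<in>{0..1}. squeeze h c x = y \<and> (x = y \<or> x = 2 * y \<or> x = y + h \<or> x = (y + c) / 2)"
    if y: "y \<in> {0..1}" for y
  proof -
    consider "y \<ge> c" | "y \<le> h" | "h \<le> y" "y \<le> c - 2 * h" | "c - 2 * h \<le> y" "y \<le> c"
      by linarith
    then show ?thesis
    proof cases
      case 1
      then show ?thesis using y hc by (intro bexI[of _ y]) (auto simp: squeeze_eq[OF hc])
    next
      case 2
      then have "2 * y \<in> {0..1}" using y hc by auto
      then show ?thesis using 2 y hc by (intro bexI[of _ "2 * y"]) (simp_all add: squeeze_eq[OF hc] field_simps)
    next
      case 3
      then have "y + h \<in> {0..1}" using y hc by auto
      then show ?thesis using 3 y hc by (intro bexI[of _ "y + h"]) (simp_all add: squeeze_eq[OF hc] field_simps)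
    next
      case 4
      then have "(y + c) / 2 \<in> {0..1}" using y hc by auto
      then show ?thesis using 4 y hc by (intro bexI[of _ "(y + c) / 2"]) (simp_all add: squeeze_eq[OF hc] field_simps)
    qed
  qed
  have img: "squeeze h c ` {0..1} = {0..1}"
  proof (intro equalityI subsetI)
    fix y :: real assume "y \<in> {0..1}"
    then show "y \<in> squeeze h c ` {0..1}" using surj[of y] by blast
  next
    fix y assume "y \<in> squeeze h c ` {0..1}"
    then show "y \<in> {0..1}" using squeeze_mem[OF _ hc(1)] by blast
  qed
  obtain \<psi> where \<psi>: "homeomorphism {0..1} {0..1} (squeeze h c) \<psi>"
    using homeomorphism_compact[OF compact_Icc cont img strict_mono_on_imp_inj_on[OF mono]] by blast
  show ?thesis
  proof (rule thompson_carrierI[OF _ \<psi> mono])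
    show "squeeze h c \<in> extensional {0..1}" by (simp add: squeeze_def)
    show "squeeze h c ` (dyadic \<inter> {0..1}) = dyadic \<inter> {0..1}"
    proof (intro equalityI subsetI)
      fix y assume "y \<in> squeeze h c ` (dyadic \<inter> {0..1})"
      then obtain x where x: "x \<in> dyadic" "x \<in> {0..1}" and y: "y = squeeze h c x" by blast
      have "y = x \<or> y = x / 2 \<or> y = x - h \<or> y = 2 * x - c"
        unfolding y sq[OF x(2)] by linarith
      then have "y \<in> dyadic"
        using x(1) dy dyadic_diff dyadic_half dyadic_double by blast
      then show "y \<in> dyadic \<inter> {0..1}"
        using squeeze_mem[OF x(2) hc(1)] y by blast
    next
      fix y assume y: "y \<in> dyadic \<inter> {0..1}"
      then obtain x where x: "x \<in> {0..1}" "squeeze h c x = y"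
        "x = y \<or> x = 2 * y \<or> x = y + h \<or> x = (y + c) / 2"
        using surj[of y] by blast
      from y have "y \<in> dyadic" by blast
      with x(3) have "x \<in> dyadic"
        using dy dyadic_add dyadic_half dyadic_double by blast
      with x show "y \<in> squeeze h c ` (dyadic \<inter> {0..1})" by blast
    qed
    show "{2 * h, c - h, c} \<subseteq> dyadic"
      using dy by (auto intro: dyadic_diff dyadic_double)
    show "dyadic_pl {2 * h, c - h, c} (squeeze h c)"
      unfolding dyadic_pl_def
    proof (intro conjI allI impI)
      fix u v :: real assume uv: "0 \<le> u \<and> u < v \<and> v \<le> 1 \<and> {2 * h, c - h, c} \<inter> {u<..<v} = {}"
      then have "v \<le> 2 * h \<or> 2 * h \<le> u" "v \<le> c - h \<or> c - h \<le> u" "v \<le> c \<or> c \<le> u"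
        by auto
      then consider "v \<le> 2 * h" | "2 * h \<le> u" "v \<le> c - h" | "c - h \<le> u" "v \<le> c" | "c \<le> u"
        using hc by linarith
      then show "\<exists>(k::int) d. \<forall>t\<in>{u..v}. squeeze h c t = 2 powi k * t + d"
      proof cases
        case 1
        then show ?thesis using uv hc
          by (intro exI[of _ "-1"] exI[of _ 0]) (auto simp: squeeze_eq[OF hc] power_int_minus)
      next
        case 2
        then show ?thesis using uv hc
          by (intro exI[of _ 0] exI[of _ "-h"]) (auto simp: squeeze_eq[OF hc])
      next
        case 3
        then show ?thesis using uv hc
          by (intro exI[of _ 1] exI[of _ "-c"]) (auto simp: squeeze_eq[OF hc])
      next
        case 4
        then show ?thesis using uv hc
          by (intro exI[of _ 0] exI[of _ 0]) (auto simp: squeeze_eq[OF hc])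
      qed
    qed simp
  qed
qed

section \<open>Iterates of the squeezing maps\<close>

lemma thompson_carrier_mem:
  "g \<in> thompson_carrier \<Longrightarrow> x \<in> {0..1} \<Longrightarrow> g x \<in> {0..1}"
  using bij_betwE[OF thompson_carrier_bij_betw] by blast

text \<open>Iteration by \<open>compose\<close> keeps the powers extensional, hence in the carrier;
  on [0, 1] they are the ordinary iterates.\<close>

primrec cpow :: "(real \<Rightarrow> real) \<Rightarrow> nat \<Rightarrow> real \<Rightarrow> real" where
  "cpow g 0 = (\<lambda>x\<in>{0..1}. x)"
| "cpow g (Suc n) = compose {0..1} (cpow g n) g"

lemma cpow_in_thompson_carrier: "g \<in> thompson_carrier \<Longrightarrow> cpow g n \<in> thompson_carrier"
  by (induction n) (auto intro: thompson_carrier_id thompson_carrier_compose)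

lemma cpow_eq_funpow:
  assumes "g \<in> thompson_carrier" "x \<in> {0..1}"
  shows "cpow g n x = (g ^^ n) x"
  using assms(2)
proof (induction n arbitrary: x)
  case (Suc n)
  then show ?case
    using Suc.IH[OF thompson_carrier_mem[OF assms(1) Suc.prems]]
    by (simp add: compose_def funpow_swap1)
qed simp

lemma funpow_squeeze_fixed:
  assumes "c \<le> x" "x \<le> 1" "0 < h" "0 \<le> c"
  shows "(squeeze h c ^^ n) x = x"
proof (induction n)
  case (Suc n)
  have "squeeze h c x = x" using assms by (simp add: squeeze_def)
  with Suc.IH show ?case by simp
qed simp

text \<open>The lower bound has n + 1 rather than n: the last of the n steps must still start in the
  translating zone, at a point not below 2 * h.\<close>

lemma funpow_squeeze_shift:
  assumes "0 < h" "real (Suc n) * h \<le> x" "x \<le> 1 - h"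
  shows "(squeeze h 1 ^^ n) x = x - real n * h"
  using assms(2)
proof (induction n)
  case (Suc n)
  from Suc.prems have *: "real (Suc n) * h \<le> x" "2 * h \<le> x - real n * h"
    using assms(1) by (auto simp: algebra_simps)
  moreover have "x - real n * h \<le> 1 - h"
    using assms by (smt (verit) mult_nonneg_nonneg of_nat_0_le_iff)
  ultimately show ?case
    unfolding funpow.simps comp_apply Suc.IH[OF *(1)]
    using assms squeeze_eq(2)[of h 1 "x - real n * h"] by (simp add: algebra_simps)
qed simp

lemma funpow_squeeze_half:
  assumes "0 < c" "c \<le> 1"
  shows "(squeeze (c / 4) c ^^ n) (c / 2) = c / 2 ^ Suc n"
proof (induction n)
  case (Suc n)
  define e where "e = c / 2 ^ Suc n"
  have "0 < e" "e \<le> c / 2"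
    using assms by (auto simp: e_def field_simps)
  then have "squeeze (c / 4) c e = e / 2"
    using assms by (intro squeeze_eq) auto
  then show ?case using Suc.IH by (simp add: e_def)
qed simp

text \<open>On the last quarter of [0, c] the distance to c doubles at every step, so n steps bring
  it from c / 2^(n+1) up to c / 2.\<close>

lemma funpow_squeeze_towards_half:
  assumes "0 < c" "c \<le> 1"
  shows "(squeeze (c / 4) c ^^ n) (c - c / 2 ^ Suc n) = c / 2"
proof (induction n)
  case (Suc n)
  define e where "e = c / 2 ^ Suc (Suc n)"
  have e: "0 < e" "e \<le> c / 4" "2 * e = c / 2 ^ Suc n"
    using assms by (auto simp: e_def field_simps)
  have "squeeze (c / 4) c (c - e) = c - 2 * e"
    using e assms by (subst squeeze_eq) auto
  then show ?case using Suc.IH e(3)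
    by (simp add: funpow_swap1 flip: e_def del: power_Suc)
qed simp

text \<open>After n steps the point is at c / 2, and n further halvings follow. The two phases
  mirror each other, so one sequence of widths serves at both ends of [0, c].\<close>

lemma funpow_squeeze_push:
  assumes "0 < c" "c \<le> 1"
  shows "(squeeze (c / 4) c ^^ (n + n)) (c - c / 2 ^ Suc n) = c / 2 ^ Suc n"
  unfolding funpow_add comp_apply funpow_squeeze_towards_half[OF assms]
  by (rule funpow_squeeze_half[OF assms])


section \<open>The Koopman representation is unitary\<close>

lemma space_unit: "space \<mu> = {0..1}"
  by (simp add: space_restrict_space)

lemma sets_unit_iff: "A \<in> sets \<mu> \<longleftrightarrow> A \<in> sets borel \<and> A \<subseteq> {0..1}"
  by (subst sets_restrict_space_iff) auto

interpretation unit: finite_measure \<mu>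
  by (rule finite_measureI) (simp add: space_unit emeasure_restrict_space)

text \<open>Negligible sets give access to the theorem that differentiable maps preserve
  negligibility.\<close>

lemma null_sets_unit_iff: "N \<in> null_sets \<mu> \<longleftrightarrow> N \<in> sets borel \<and> N \<subseteq> {0..1} \<and> negligible N"
proof -
  have "negligible N \<longleftrightarrow> N \<in> null_sets lborel" if "N \<in> sets borel"
    using that by (simp add: negligible_iff_null_sets null_sets_completion_iff)
  moreover have "N \<in> sets borel" if "N \<in> null_sets lborel"
    using null_setsD2[OF that] by simp
  ultimately show ?thesis by (auto simp: null_sets_restrict_space)
qed

lemma thompson_measurable:
  assumes "g \<in> thompson_carrier"
  shows "g \<in> measurable \<mu> \<mu>"
proof (rule measurable_restrict_space2)
  show "g \<in> space \<mu> \<rightarrow> {0..1}"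
    using thompson_carrier_mem[OF assms] by (auto simp: space_unit)
  have "g \<in> borel_measurable (restrict_space borel {0..1})"
    by (rule borel_measurable_continuous_on_restrict[OF thompson_carrier_continuous[OF assms]])
  then show "g \<in> measurable \<mu> lborel"
    by (simp add: measurable_cong_sets[OF sets_restrict_space_cong[OF sets_lborel] sets_lborel])
qed

text \<open>The restriction makes the inverse extensional and thus itself an element of the group,
  so that every fact about group elements applies to it.\<close>

definition tinv :: "(real \<Rightarrow> real) \<Rightarrow> real \<Rightarrow> real" where
  "tinv g = restrict (inv_into {0..1} g) {0..1}"

lemma tinv_in_thompson_carrier: "g \<in> thompson_carrier \<Longrightarrow> tinv g \<in> thompson_carrier"
  unfolding tinv_def by (rule thompson_carrier_inverse)

lemma tinv_left:
  assumes "g \<in> thompson_carrier" "x \<in> {0..1}"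
  shows "tinv g (g x) = x"
  using bij_betw_inv_into_left[OF thompson_carrier_bij_betw[OF assms(1)] assms(2)]
    thompson_carrier_mem[OF assms] by (simp add: tinv_def)

lemma tinv_right:
  assumes "g \<in> thompson_carrier" "x \<in> {0..1}"
  shows "g (tinv g x) = x"
  using bij_betw_inv_into_right[OF thompson_carrier_bij_betw[OF assms(1)] assms(2)] assms(2)
  by (simp add: tinv_def)

lemma tinv_tinv:
  assumes "g \<in> thompson_carrier" "x \<in> {0..1}"
  shows "tinv (tinv g) x = g x"
  using tinv_left[OF tinv_in_thompson_carrier[OF assms(1)] thompson_carrier_mem[OF assms]]
    tinv_left[OF assms] by simp

lemma tinv_compose:
  assumes g: "g \<in> thompson_carrier" and h: "h \<in> thompson_carrier" and x: "x \<in> {0..1}"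
  shows "tinv (compose {0..1} g h) x = tinv h (tinv g x)"
proof -
  have y: "tinv g x \<in> {0..1}" "tinv h (tinv g x) \<in> {0..1}"
    using thompson_carrier_mem tinv_in_thompson_carrier g h x by auto
  have "compose {0..1} g h (tinv h (tinv g x)) = x"
    using y g h x by (simp add: compose_def tinv_right)
  then show ?thesis
    using tinv_left[OF thompson_carrier_compose[OF g h] y(2)] by simp
qed

lemma thompson_vimage_eq:
  assumes "g \<in> thompson_carrier" "N \<subseteq> {0..1}"
  shows "g -` N \<inter> {0..1} = tinv g ` N"
proof (intro equalityI subsetI)
  fix x assume "x \<in> g -` N \<inter> {0..1}"
  then show "x \<in> tinv g ` N" using tinv_left[OF assms(1), of x] by (metis IntE imageI vimageE)
next
  fix x assume "x \<in> tinv g ` N"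
  then show "x \<in> g -` N \<inter> {0..1}"
    using tinv_right[OF assms(1)] thompson_carrier_mem[OF tinv_in_thompson_carrier[OF assms(1)]]
      assms(2) by auto
qed

text \<open>Outside the finite set of nondifferentiability points the map is differentiable; the
  image of that finite set is finite.\<close>

lemma thompson_negligible_image:
  assumes g: "g \<in> thompson_carrier" and N: "negligible N" "N \<subseteq> {0..1}"
  shows "negligible (g ` N)"
proof -
  define D where "D = {x\<in>{0..1}. \<not> g differentiable (at x within {0..1})}"
  have D: "finite D" using g by (simp add: D_def thompson_carrier_def)
  have "negligible (N - D)" using N(1) by (rule negligible_diff)
  moreover have "g differentiable_on (N - D)"
    unfolding differentiable_on_def
  proof
    fix x assume "x \<in> N - D"
    then have "g differentiable (at x within {0..1})" using N(2) by (auto simp: D_def)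
    then show "g differentiable (at x within N - D)"
      by (rule differentiable_within_subset) (use N(2) in auto)
  qed
  ultimately have "negligible (g ` (N - D))"
    by (intro negligible_differentiable_image_negligible) auto
  moreover have "negligible (g ` D)" using D by (intro negligible_finite) auto
  moreover have "g ` N \<subseteq> g ` (N - D) \<union> g ` D" by auto
  ultimately show ?thesis by (meson negligible_Un negligible_subset)
qed

lemma thompson_null_vimage:
  assumes g: "g \<in> thompson_carrier" and N: "N \<in> null_sets \<mu>"
  shows "g -` N \<inter> {0..1} \<in> null_sets \<mu>"
proof -
  have "g -` N \<inter> space \<mu> \<in> sets \<mu>"
    using thompson_measurable[OF g] N by (intro measurable_sets) auto
  then have "g -` N \<inter> {0..1} \<in> sets borel"
    unfolding space_unit sets_unit_iff by blast
  moreover have "negligible (g -` N \<inter> {0..1})"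
    using thompson_negligible_image[OF tinv_in_thompson_carrier[OF g]] N
    by (simp add: null_sets_unit_iff thompson_vimage_eq[OF g])
  ultimately show ?thesis by (simp add: null_sets_unit_iff)
qed

text \<open>Identities between representatives hold only almost everywhere; this permits their use
  at the moved point \<open>tinv g x\<close>.\<close>

lemma AE_thompson:
  assumes g: "g \<in> thompson_carrier" and P: "AE x in \<mu>. P x"
  shows "AE x in \<mu>. P (g x)"
proof -
  obtain N where N: "N \<in> null_sets \<mu>" "{x \<in> space \<mu>. \<not> P x} \<subseteq> N"
    using P by (auto simp: eventually_ae_filter)
  have "{x \<in> space \<mu>. \<not> P (g x)} \<subseteq> g -` N \<inter> {0..1}"
  proof
    fix x assume "x \<in> {x \<in> space \<mu>. \<not> P (g x)}"
    then have x: "x \<in> {0..1}" "\<not> P (g x)" by (simp_all add: space_unit)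
    have "g x \<in> {x \<in> space \<mu>. \<not> P x}"
      using x thompson_carrier_mem[OF g x(1)] by (simp add: space_unit)
    with N(2) have "g x \<in> N" by (rule subsetD)
    with x show "x \<in> g -` N \<inter> {0..1}" by simp
  qed
  then show ?thesis
    by (rule AE_I'[OF thompson_null_vimage[OF g N(1)]])
qed

section \<open>The Radon-Nikodym derivative as a cocycle\<close>

definition jac :: "(real \<Rightarrow> real) \<Rightarrow> real \<Rightarrow> real" where
  "jac g x = enn2real (RN_deriv \<mu> (distr \<mu> \<mu> g) x)"

lemma jac_measurable [measurable]: "jac g \<in> borel_measurable \<mu>"
  unfolding jac_def by measurable

lemma jac_nonneg: "0 \<le> jac g x"
  by (simp add: jac_def)

text \<open>Passing to real values by \<open>enn2real\<close> loses nothing: the push-forward is a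
  finite measure, so its derivative is finite almost everywhere.\<close>

lemma distr_eq_density_jac:
  assumes g: "g \<in> thompson_carrier"
  shows "distr \<mu> \<mu> g = density \<mu> (\<lambda>x. ennreal (jac g x))"
proof -
  note [measurable] = thompson_measurable[OF g]
  have ac: "absolutely_continuous \<mu> (distr \<mu> \<mu> g)"
    unfolding absolutely_continuous_def
  proof
    fix N assume N: "N \<in> null_sets \<mu>"
    then show "N \<in> null_sets (distr \<mu> \<mu> g)"
      using thompson_null_vimage[OF g N] by (auto simp: null_sets_def emeasure_distr space_unit)
  qed
  have fin: "finite_measure (distr \<mu> \<mu> g)"
    by (rule unit.finite_measure_distr) simp
  then interpret d: finite_measure "distr \<mu> \<mu> g" .
  have "density \<mu> (RN_deriv \<mu> (distr \<mu> \<mu> g)) = distr \<mu> \<mu> g"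
    using ac by (intro unit.density_RN_deriv) auto
  moreover have "AE x in \<mu>. RN_deriv \<mu> (distr \<mu> \<mu> g) x \<noteq> \<infinity>"
    using ac by (intro unit.RN_deriv_finite d.sigma_finite_measure_axioms) auto
  then have "density \<mu> (RN_deriv \<mu> (distr \<mu> \<mu> g)) = density \<mu> (\<lambda>x. ennreal (jac g x))"
    by (intro density_cong) (auto simp: jac_def less_top)
  ultimately show ?thesis by simp
qed

text \<open>The push-forward gives no mass to the zero set \<open>Z\<close>, so the preimage of
  \<open>Z\<close> under \<open>g\<close> is null. Applying the null-set lemma to the inverse brings
  this back to \<open>Z\<close>.\<close>

lemma jac_pos:
  assumes g: "g \<in> thompson_carrier"
  shows "AE x in \<mu>. 0 < jac g x"
proof -
  note [measurable] = thompson_measurable[OF g]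
  define Z where "Z = {x \<in> space \<mu>. jac g x = 0}"
  have Z [measurable]: "Z \<in> sets \<mu>" unfolding Z_def by measurable
  have "emeasure (distr \<mu> \<mu> g) Z = (\<integral>\<^sup>+x. ennreal (jac g x) * indicator Z x \<partial>\<mu>)"
    unfolding distr_eq_density_jac[OF g] by (rule emeasure_density) auto
  also have "\<dots> = (\<integral>\<^sup>+x. 0 \<partial>\<mu>)"
    by (rule nn_integral_cong) (auto simp: Z_def indicator_def)
  finally have "g -` Z \<inter> {0..1} \<in> null_sets \<mu>"
    using measurable_sets[OF thompson_measurable[OF g] Z]
    by (auto simp: null_sets_def emeasure_distr space_unit)
  from thompson_null_vimage[OF tinv_in_thompson_carrier[OF g] this]
  have "tinv g -` (g -` Z \<inter> {0..1}) \<inter> {0..1} \<in> null_sets \<mu>" .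
  moreover have "Z \<subseteq> tinv g -` (g -` Z \<inter> {0..1}) \<inter> {0..1}"
  proof
    fix x assume x: "x \<in> Z"
    then have x01: "x \<in> {0..1}" by (simp add: Z_def space_unit)
    then show "x \<in> tinv g -` (g -` Z \<inter> {0..1}) \<inter> {0..1}"
      using x thompson_carrier_mem[OF tinv_in_thompson_carrier[OF g] x01] tinv_right[OF g x01] by simp
  qed
  ultimately have "Z \<in> null_sets \<mu>" by (rule null_sets_subset[OF _ Z])
  then have "AE x in \<mu>. x \<notin> Z" by (rule AE_not_in)
  then show ?thesis
    using AE_space[of \<mu>]
    by eventually_elim (use jac_nonneg[of g] in \<open>auto simp: Z_def less_le\<close>)
qed

lemma nn_integral_jac:
  assumes g: "g \<in> thompson_carrier" and F [measurable]: "F \<in> borel_measurable \<mu>"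
  shows "(\<integral>\<^sup>+x. ennreal (jac g x) * F x \<partial>\<mu>) = (\<integral>\<^sup>+x. F (g x) \<partial>\<mu>)"
proof -
  note [measurable] = thompson_measurable[OF g]
  have "(\<integral>\<^sup>+x. ennreal (jac g x) * F x \<partial>\<mu>) = (\<integral>\<^sup>+x. F x \<partial>density \<mu> (\<lambda>x. ennreal (jac g x)))"
    by (rule nn_integral_density[symmetric]) auto
  also have "\<dots> = (\<integral>\<^sup>+x. F (g x) \<partial>\<mu>)"
    unfolding distr_eq_density_jac[OF g, symmetric] by (rule nn_integral_distr) auto
  finally show ?thesis .
qed

text \<open>On subsets of \<open>S\<close> the push-forward coincides with the Lebesgue measure, so
  the two densities agree there by uniqueness. This holds even if \<open>S\<close> has no
  interior.\<close>

lemma jac_local: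
  assumes g: "g \<in> thompson_carrier" and S [measurable]: "S \<in> sets \<mu>"
    and fixed: "\<And>x. x \<in> S \<Longrightarrow> g x = x"
  shows "AE x in \<mu>. x \<in> S \<longrightarrow> jac g x = 1"
proof -
  note [measurable] = thompson_measurable[OF g]
  have S01: "S \<subseteq> {0..1}" using S by (simp add: sets_unit_iff)
  \<comment> \<open>If \<open>g x\<close> lies in \<open>S\<close> then it is a fixed point, and
    injectivity forces \<open>g x = x\<close>.\<close>
  have gS: "g x \<in> S \<longleftrightarrow> x \<in> S" if "x \<in> {0..1}" for x
    using fixed[of x] fixed[of "g x"] tinv_left[OF g that] tinv_left[OF g, of "g x"]
      thompson_carrier_mem[OF g that] by metis
  have "AE x in \<mu>. ennreal (jac g x) * indicator S x = indicator S x"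
  proof (rule unit.density_unique2)
    fix A assume A [measurable]: "A \<in> sets \<mu>"
    have "(\<integral>\<^sup>+x\<in>A. (ennreal (jac g x) * indicator S x) \<partial>\<mu>)
        = (\<integral>\<^sup>+x. ennreal (jac g x) * (indicator S x * indicator A x) \<partial>\<mu>)"
      by (simp add: mult_ac)
    also have "\<dots> = (\<integral>\<^sup>+x. indicator S (g x) * indicator A (g x) \<partial>\<mu>)"
      by (rule nn_integral_jac[OF g]) measurable
    also have "\<dots> = (\<integral>\<^sup>+x\<in>A. indicator S x \<partial>\<mu>)"
    proof (rule nn_integral_cong)
      fix x assume "x \<in> space \<mu>"
      then show "indicator S (g x) * indicator A (g x) = (indicator S x * indicator A x :: ennreal)"
        using gS[of x] fixed[of x] by (auto simp: space_unit indicator_def)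
    qed
    finally show "(\<integral>\<^sup>+x\<in>A. (ennreal (jac g x) * indicator S x) \<partial>\<mu>)
        = (\<integral>\<^sup>+x\<in>A. indicator S x \<partial>\<mu>)" .
  qed auto
  then show ?thesis
    by eventually_elim (auto simp: indicator_def jac_nonneg split: if_splits)
qed

text \<open>A chain rule without derivatives: both sides have the same integral over every
  measurable set, by three changes of variables.\<close>

lemma jac_compose:
  assumes g: "g \<in> thompson_carrier" and h: "h \<in> thompson_carrier"
  shows "AE x in \<mu>. jac (compose {0..1} g h) x = jac g x * jac h (tinv g x)"
proof -
  note [measurable] = thompson_measurable[OF g] thompson_measurable[OF h]
    thompson_measurable[OF tinv_in_thompson_carrier[OF g]]
    thompson_measurable[OF thompson_carrier_compose[OF g h]]
  have "AE x in \<mu>. ennreal (jac (compose {0..1} g h) x) = ennreal (jac g x) * ennreal (jac h (tinv g x))"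
  proof (rule unit.density_unique2)
    fix A assume A [measurable]: "A \<in> sets \<mu>"
    have "(\<integral>\<^sup>+x\<in>A. (ennreal (jac g x) * ennreal (jac h (tinv g x))) \<partial>\<mu>)
        = (\<integral>\<^sup>+x. ennreal (jac g x) * (ennreal (jac h (tinv g x)) * indicator A x) \<partial>\<mu>)"
      by (simp add: mult_ac)
    also have "\<dots> = (\<integral>\<^sup>+x. ennreal (jac h (tinv g (g x))) * indicator A (g x) \<partial>\<mu>)"
      by (rule nn_integral_jac[OF g]) measurable
    also have "\<dots> = (\<integral>\<^sup>+x. ennreal (jac h x) * indicator A (g x) \<partial>\<mu>)"
      by (rule nn_integral_cong) (simp add: space_unit tinv_left[OF g])
    also have "\<dots> = (\<integral>\<^sup>+x. indicator A (g (h x)) \<partial>\<mu>)"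
      by (rule nn_integral_jac[OF h]) measurable
    also have "\<dots> = (\<integral>\<^sup>+x. indicator A (compose {0..1} g h x) \<partial>\<mu>)"
      by (rule nn_integral_cong) (simp add: space_unit compose_def)
    also have "\<dots> = (\<integral>\<^sup>+x\<in>A. ennreal (jac (compose {0..1} g h) x) \<partial>\<mu>)"
      by (rule nn_integral_jac[OF thompson_carrier_compose[OF g h], symmetric]) measurable
    finally show "(\<integral>\<^sup>+x\<in>A. ennreal (jac (compose {0..1} g h) x) \<partial>\<mu>)
        = (\<integral>\<^sup>+x\<in>A. (ennreal (jac g x) * ennreal (jac h (tinv g x))) \<partial>\<mu>)" by simp
  qed auto
  then show ?thesis
    by eventually_elim (simp add: jac_nonneg flip: ennreal_mult)
qed

lemma integral_jac:
  fixes F :: "real \<Rightarrow> complex"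
  assumes g: "g \<in> thompson_carrier" and F [measurable]: "F \<in> borel_measurable \<mu>"
  shows "(\<integral>x. jac g x *\<^sub>R F (tinv g x) \<partial>\<mu>) = (\<integral>x. F x \<partial>\<mu>)"
proof -
  note [measurable] = thompson_measurable[OF g] thompson_measurable[OF tinv_in_thompson_carrier[OF g]]
  have "(\<integral>x. jac g x *\<^sub>R F (tinv g x) \<partial>\<mu>) = (\<integral>x. F (tinv g x) \<partial>density \<mu> (\<lambda>x. ennreal (jac g x)))"
    by (rule integral_density[symmetric]) (auto simp: jac_nonneg)
  also have "\<dots> = (\<integral>x. F (tinv g (g x)) \<partial>\<mu>)"
    unfolding distr_eq_density_jac[OF g, symmetric] by (rule integral_distr) auto
  also have "\<dots> = (\<integral>x. F x \<partial>\<mu>)"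
    by (rule Bochner_Integration.integral_cong) (auto simp: space_unit tinv_left[OF g])
  finally show ?thesis .
qed

section \<open>The operators on functions and on their classes\<close>

definition koopman_fun :: "real \<Rightarrow> (real \<Rightarrow> real) \<Rightarrow> (real \<Rightarrow> complex) \<Rightarrow> real \<Rightarrow> complex" where
  "koopman_fun s g f x = complex_of_real (jac g x) powr (1 / 2 + \<i> * complex_of_real s) * f (tinv g x)"

lemma norm_jac_powr:
  "(cmod (complex_of_real (jac g x) powr (1 / 2 + \<i> * complex_of_real s)))\<^sup>2 = jac g x"
  using jac_nonneg[of g x] by (subst norm_powr_real_powr) (auto simp: powr_half_sqrt)

text \<open>For a nonnegative base the complex power is an exponential of the real logarithm, so the
  branch cut does not matter. The base 0 is split off, where \<open>powr\<close> has the value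
  0.\<close>

lemma measurable_powr_complex:
  assumes [measurable]: "u \<in> borel_measurable M" and nonneg: "\<And>x. 0 \<le> u x"
  shows "(\<lambda>x. complex_of_real (u x) powr z) \<in> borel_measurable M"
proof -
  have "complex_of_real (u x) powr z
      = (if u x = 0 then 0 else exp (z * complex_of_real (ln (u x))))" for x
    using nonneg[of x] by (auto simp: powr_def Ln_of_real less_le)
  then show ?thesis by simp
qed

lemma square_integrable_koopman_fun:
  assumes g: "g \<in> thompson_carrier" and f: "square_integrable f"
  shows "square_integrable (koopman_fun s g f)"
proof -
  note [measurable] = thompson_measurable[OF g] thompson_measurable[OF tinv_in_thompson_carrier[OF g]]
    measurable_powr_complex[OF jac_measurable jac_nonneg]
  have [measurable]: "f \<in> borel_measurable \<mu>" using f by (simp add: square_integrable_def)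
  have meas: "koopman_fun s g f \<in> borel_measurable \<mu>"
    unfolding koopman_fun_def by measurable
  have "(\<integral>\<^sup>+x. ennreal ((cmod (koopman_fun s g f x))\<^sup>2) \<partial>\<mu>)
      = (\<integral>\<^sup>+x. ennreal (jac g x) * ennreal ((cmod (f (tinv g x)))\<^sup>2) \<partial>\<mu>)"
    by (simp add: koopman_fun_def norm_mult power_mult_distrib norm_jac_powr ennreal_mult jac_nonneg)
  also have "\<dots> = (\<integral>\<^sup>+x. ennreal ((cmod (f (tinv g (g x))))\<^sup>2) \<partial>\<mu>)"
    by (rule nn_integral_jac[OF g]) measurable
  also have "\<dots> = (\<integral>\<^sup>+x. ennreal ((cmod (f x))\<^sup>2) \<partial>\<mu>)"
    by (rule nn_integral_cong) (simp add: space_unit tinv_left[OF g])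
  also have "\<dots> < \<infinity>"
    using f by (simp add: square_integrable_def nn_integral_eq_integral)
  finally show ?thesis
    using meas by (auto simp: square_integrable_def intro!: integrableI_bounded)
qed

lemma l2_eqI:
  assumes "AE x in \<mu>. rep_l2 v x = rep_l2 w x"
  shows "v = w"
  using assms square_integrable_rep[of v] square_integrable_rep[of w] Quotient_rel_rep[OF Quotient_l2, of v w]
  by (simp add: l2_rel_def)

lemma abs_l2_cong:
  assumes "square_integrable f" "square_integrable f'" "AE x in \<mu>. f x = f' x"
  shows "abs_l2 f = abs_l2 f'"
  using assms Quotient_rel_abs[OF Quotient_l2, of f f'] by (simp add: l2_rel_def)

lemma rep_l2_add: "AE x in \<mu>. rep_l2 (v + w) x = rep_l2 v x + rep_l2 w x"
proof -
  have "v + w = abs_l2 (\<lambda>x. rep_l2 v x + rep_l2 w x)"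
    by (subst (1 2) Quotient_abs_rep[OF Quotient_l2, symmetric])
      (simp add: plus_l2.abs_eq l2_rel_rep)
  then show ?thesis
    using rep_abs_l2[OF square_integrable_add[OF square_integrable_rep square_integrable_rep], of v w]
    by simp
qed

lemma rep_l2_scaleC: "AE x in \<mu>. rep_l2 (c *\<^sub>C v) x = c * rep_l2 v x"
proof -
  have "c *\<^sub>C v = abs_l2 (\<lambda>x. c * rep_l2 v x)"
    by (subst (1) Quotient_abs_rep[OF Quotient_l2, symmetric])
      (simp add: scaleC_l2.abs_eq l2_rel_rep)
  then show ?thesis
    using rep_abs_l2[OF square_integrable_cmult[OF square_integrable_rep], of c v] by simp
qed

lemma cinner_l2_eq: "cinner v w = (\<integral>x. rep_l2 v x * cnj (rep_l2 w x) \<partial>\<mu>)"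
  by (simp add: cinner_l2.rep_eq)

text \<open>The bare \<open>inv_into\<close> and \<open>tinv\<close> can differ only outside [0, 1],
  which the measure space does not contain.\<close>

lemma koopman_rep_eq:
  assumes g: "g \<in> thompson_carrier"
  shows "koopman_rep s g v = abs_l2 (koopman_fun s g (rep_l2 v))"
proof -
  have sq: "square_integrable (koopman_fun s g (rep_l2 v))"
    by (rule square_integrable_koopman_fun[OF g square_integrable_rep])
  let ?F = "\<lambda>x. complex_of_real (enn2real (RN_deriv \<mu> (distr \<mu> \<mu> g) x)) powr (1 / 2 + \<i> * complex_of_real s)
       * rep_l2 v (inv_into {0..1} g x)"
  have eq: "?F x = koopman_fun s g (rep_l2 v) x" if "x \<in> space \<mu>" for x
    using that by (simp add: koopman_fun_def jac_def space_unit tinv_def)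
  have "?F \<in> borel_measurable \<mu> \<longleftrightarrow> koopman_fun s g (rep_l2 v) \<in> borel_measurable \<mu>"
    by (rule measurable_cong[OF eq])
  moreover have "integrable \<mu> (\<lambda>x. (cmod (?F x))\<^sup>2)
      \<longleftrightarrow> integrable \<mu> (\<lambda>x. (cmod (koopman_fun s g (rep_l2 v) x))\<^sup>2)"
    by (rule Bochner_Integration.integrable_cong[OF refl]) (simp only: eq)
  ultimately have "square_integrable ?F"
    using sq by (simp only: square_integrable_def)
  then show ?thesis
    unfolding koopman_rep_def by (intro abs_l2_cong sq AE_I2 eq)
qed

lemma rep_koopman:
  assumes g: "g \<in> thompson_carrier"
  shows "AE x in \<mu>. rep_l2 (koopman_rep s g v) x
    = complex_of_real (jac g x) powr (1 / 2 + \<i> * complex_of_real s) * rep_l2 v (tinv g x)"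
  unfolding koopman_rep_eq[OF g]
  using rep_abs_l2[OF square_integrable_koopman_fun[OF g square_integrable_rep]]
  by (simp add: koopman_fun_def)

lemma koopman_add:
  assumes g: "g \<in> thompson_carrier"
  shows "koopman_rep s g (v + w) = koopman_rep s g v + koopman_rep s g w"
  by (rule l2_eqI)
    (use rep_koopman[OF g, of s "v + w"] rep_koopman[OF g, of s v] rep_koopman[OF g, of s w]
      rep_l2_add[of "koopman_rep s g v" "koopman_rep s g w"]
      AE_thompson[OF tinv_in_thompson_carrier[OF g] rep_l2_add[of v w]]
     in \<open>eventually_elim, simp add: algebra_simps\<close>)

lemma koopman_scaleC:
  assumes g: "g \<in> thompson_carrier"
  shows "koopman_rep s g (c *\<^sub>C v) = c *\<^sub>C koopman_rep s g v"
  by (rule l2_eqI)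
    (use rep_koopman[OF g, of s "c *\<^sub>C v"] rep_koopman[OF g, of s v]
      rep_l2_scaleC[of c "koopman_rep s g v"]
      AE_thompson[OF tinv_in_thompson_carrier[OF g] rep_l2_scaleC[of c v]]
     in \<open>eventually_elim, simp add: algebra_simps\<close>)

lemma koopman_cinner:
  assumes g: "g \<in> thompson_carrier"
  shows "cinner (koopman_rep s g v) (koopman_rep s g w) = cinner v w"
proof -
  let ?J = "\<lambda>x. complex_of_real (jac g x) powr (1 / 2 + \<i> * complex_of_real s)"
  let ?F = "\<lambda>x. rep_l2 v x * cnj (rep_l2 w x)"
  have F: "?F \<in> borel_measurable \<mu>"
    by (intro borel_measurable_integrable integrable_mult_cnj square_integrable_rep)
  have J: "?J x * cnj (?J x) = complex_of_real (jac g x)" for x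
    unfolding complex_norm_square[symmetric] norm_jac_powr ..
  have "cinner (koopman_rep s g v) (koopman_rep s g w) = (\<integral>x. jac g x *\<^sub>R ?F (tinv g x) \<partial>\<mu>)"
    unfolding cinner_l2_eq
  proof (rule integral_cong_AE)
    show "(\<lambda>x. rep_l2 (koopman_rep s g v) x * cnj (rep_l2 (koopman_rep s g w) x)) \<in> borel_measurable \<mu>"
      by (intro borel_measurable_integrable integrable_mult_cnj square_integrable_rep)
    show "(\<lambda>x. jac g x *\<^sub>R ?F (tinv g x)) \<in> borel_measurable \<mu>"
      using measurable_compose[OF thompson_measurable[OF tinv_in_thompson_carrier[OF g]] F]
      by measurable
    show "AE x in \<mu>. rep_l2 (koopman_rep s g v) x * cnj (rep_l2 (koopman_rep s g w) x)
        = jac g x *\<^sub>R ?F (tinv g x)"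
      using rep_koopman[OF g, of s v] rep_koopman[OF g, of s w]
    proof eventually_elim
      case (elim x)
      have "rep_l2 (koopman_rep s g v) x * cnj (rep_l2 (koopman_rep s g w) x)
          = (?J x * cnj (?J x)) * ?F (tinv g x)"
        unfolding elim by (simp add: mult_ac)
      then show ?case unfolding J by (simp add: scaleR_conv_of_real)
    qed
  qed
  also have "\<dots> = cinner v w"
    unfolding cinner_l2_eq by (rule integral_jac[OF g F])
  finally show ?thesis .
qed

text \<open>This is the cocycle rule raised to a complex power; multiplicativity of
  \<open>powr\<close> is available because the factors are nonnegative reals.\<close>

lemma koopman_compose:
  assumes g: "g \<in> thompson_carrier" and h: "h \<in> thompson_carrier"
  shows "koopman_rep s (compose {0..1} g h) v = koopman_rep s g (koopman_rep s h v)"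
  by (rule l2_eqI)
    (use rep_koopman[OF thompson_carrier_compose[OF g h], of s v]
      rep_koopman[OF g, of s "koopman_rep s h v"] jac_compose[OF g h] AE_space[of \<mu>]
      AE_thompson[OF tinv_in_thompson_carrier[OF g] rep_koopman[OF h, of s v]]
     in \<open>eventually_elim, simp add: tinv_compose[OF g h] space_unit powr_times_real jac_nonneg\<close>)

lemma koopman_id: "koopman_rep s (\<lambda>x\<in>{0..1}. x) v = v"
proof (rule l2_eqI)
  have inv: "tinv (\<lambda>x\<in>{0..1}. x) x = x" if "x \<in> {0..1}" for x
    using tinv_right[OF thompson_carrier_id that]
      thompson_carrier_mem[OF tinv_in_thompson_carrier[OF thompson_carrier_id] that] by simp
  have "AE x in \<mu>. x \<in> {0..1} \<longrightarrow> jac (\<lambda>x\<in>{0..1}. x) x = 1"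
    by (rule jac_local[OF thompson_carrier_id]) (auto simp: sets_unit_iff)
  then show "AE x in \<mu>. rep_l2 (koopman_rep s (\<lambda>x\<in>{0..1}. x) v) x = rep_l2 v x"
    using rep_koopman[OF thompson_carrier_id, of s v] AE_space[of \<mu>]
    by eventually_elim (simp add: inv space_unit)
qed

lemma compose_tinv:
  assumes "g \<in> thompson_carrier"
  shows "compose {0..1} g (tinv g) = (\<lambda>x\<in>{0..1}. x)"
  by (rule ext) (simp add: compose_def tinv_right[OF assms])

lemma koopman_unitary:
  assumes g: "g \<in> thompson_carrier"
  shows "unitary (koopman_rep s g)"
  unfolding unitary_def
proof (intro conjI allI)
  show "Vector_Spaces.linear scaleC scaleC (koopman_rep s g)"
    by (simp add: Vector_Spaces.linear_iff vector_space_scaleC koopman_add[OF g] koopman_scaleC[OF g])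
  show "surj (koopman_rep s g)"
  proof (rule surjI)
    fix v
    show "koopman_rep s g (koopman_rep s (tinv g) v) = v"
      using koopman_compose[OF g tinv_in_thompson_carrier[OF g], of s v]
      by (simp only: compose_tinv[OF g] koopman_id)
  qed
  show "cinner (koopman_rep s g x) (koopman_rep s g y) = cinner x y" for x y
    by (rule koopman_cinner[OF g])
qed

lemma koopman_unitary_rep: "unitary_rep thompson_F (koopman_rep s)"
  unfolding unitary_rep_def
proof (intro conjI group_thompson_F homI)
  fix g assume "g \<in> carrier thompson_F"
  then show "koopman_rep s g \<in> carrier unitary_group"
    by (simp add: unitary_group_def carrier_thompson_F koopman_unitary)
next
  fix g h assume "g \<in> carrier thompson_F" "h \<in> carrier thompson_F"
  then show "koopman_rep s (g \<otimes>\<^bsub>thompson_F\<^esub> h)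
      = koopman_rep s g \<otimes>\<^bsub>unitary_group\<^esub> koopman_rep s h"
    by (auto simp: unitary_group_def carrier_thompson_F mult_thompson_F koopman_compose)
qed


section \<open>Orthogonality to an orbit localizes\<close>

lemma exists_orthogonal:
  fixes W :: "'a::{real_inner, complete_space} set"
  assumes W: "closed W" "subspace W" and x: "x \<notin> W"
  obtains y where "y \<noteq> 0" "\<And>w. w \<in> W \<Longrightarrow> inner w y = 0"
proof -
  define D where "D = (INF w\<in>W. (norm (x - w))\<^sup>2)"
  have W0: "0 \<in> W" by (rule subspace_0[OF W(2)])
  have bdd: "bdd_below ((\<lambda>w. (norm (x - w))\<^sup>2) ` W)" by (rule bdd_belowI2[of _ 0]) simp
  have D_le: "D \<le> (norm (x - w))\<^sup>2" if "w \<in> W" for w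
    unfolding D_def by (rule cINF_lower[OF bdd that])
  have "\<exists>w\<in>W. (norm (x - w))\<^sup>2 < D + 1 / real (Suc n)" for n
  proof (rule ccontr)
    assume "\<not> ?thesis"
    then have "D + 1 / real (Suc n) \<le> D"
      unfolding D_def using W0 by (intro cINF_greatest) (auto simp: not_less)
    then show False by simp
  qed
  then obtain w where w: "w n \<in> W" "(norm (x - w n))\<^sup>2 < D + 1 / real (Suc n)" for n
    by metis
  have diff: "(norm (w m - w n))\<^sup>2 \<le> 2 / real (Suc m) + 2 / real (Suc n)" for m n
  proof -
    have "(1/2) *\<^sub>R (w m + w n) \<in> W"
      using W(2) w(1) by (intro subspace_scale subspace_add)
    from D_le[OF this] have "4 * D \<le> 4 * (norm (x - (1/2) *\<^sub>R (w m + w n)))\<^sup>2" by simp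
    \<comment> \<open>The parallelogram law for x - w m and x - w n. The midpoint lies in
      \<open>W\<close>, so its squared distance to x is at least \<open>D\<close>, and a minimizing
      sequence must be Cauchy.\<close>
    moreover have "(norm (w m - w n))\<^sup>2 = 2 * (norm (x - w m))\<^sup>2 + 2 * (norm (x - w n))\<^sup>2
        - 4 * (norm (x - (1/2) *\<^sub>R (w m + w n)))\<^sup>2"
      by (simp add: power2_norm_eq_inner inner_simps inner_commute algebra_simps)
    ultimately show ?thesis using w(2)[of m] w(2)[of n] by simp
  qed
  have "Cauchy w"
  proof (rule CauchyI)
    fix e :: real assume e: "0 < e"
    obtain N :: nat where N: "4 / e\<^sup>2 < real N" using reals_Archimedean2 by blast
    show "\<exists>M. \<forall>m\<ge>M. \<forall>n\<ge>M. norm (w m - w n) < e"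
    proof (intro exI[of _ N] allI impI)
      fix m n assume mn: "N \<le> m" "N \<le> n"
      have le: "2 / real (Suc k) \<le> 2 / real (Suc N)" if "N \<le> k" for k
        using that by (intro divide_left_mono) auto
      have "4 / e\<^sup>2 < real (Suc N)" using N by simp
      then have "4 < real (Suc N) * e\<^sup>2" using e by (simp add: pos_divide_less_eq)
      then have "4 / real (Suc N) < e\<^sup>2" by (simp add: pos_divide_less_eq mult.commute)
      then have "2 / real (Suc N) + 2 / real (Suc N) < e\<^sup>2" by (simp flip: add_divide_distrib)
      then have "(norm (w m - w n))\<^sup>2 < e\<^sup>2"
        using diff[of m n] le[OF mn(1)] le[OF mn(2)] by argo
      then show "norm (w m - w n) < e" by (rule power2_less_imp_less) (use e in simp)
    qed
  qed
  then obtain p where p: "w \<longlonglongrightarrow> p" by (auto simp: Cauchy_convergent_iff convergent_def)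
  have pW: "p \<in> W" by (rule closed_sequentially[OF W(1) _ p]) (rule w(1))
  have "(norm (x - p))\<^sup>2 \<le> D"
  proof (rule LIMSEQ_le)
    show "(\<lambda>n. (norm (x - w n))\<^sup>2) \<longlonglongrightarrow> (norm (x - p))\<^sup>2" by (intro tendsto_intros p)
    have "(\<lambda>n. D + 1 / real (Suc n)) \<longlonglongrightarrow> D + 0"
      by (intro tendsto_intros LIMSEQ_Suc[OF lim_1_over_n])
    then show "(\<lambda>n. D + 1 / real (Suc n)) \<longlonglongrightarrow> D" by simp
    show "\<exists>N. \<forall>n\<ge>N. (norm (x - w n))\<^sup>2 \<le> D + 1 / real (Suc n)"
      using w(2) less_imp_le by blast
  qed
  have "inner v (x - p) = 0" if v: "v \<in> W" for v
  proof (cases "v = 0")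
    case False
    \<comment> \<open>The coefficient of the projection of x - p onto v. Moving from p by
      \<open>t\<close> times v would reduce the squared distance by exactly the square of the inner
      product over the squared norm of v.\<close>
    define t where "t = inner v (x - p) / (norm v)\<^sup>2"
    have "p + t *\<^sub>R v \<in> W" using W(2) pW v by (intro subspace_add subspace_scale)
    then have "(norm (x - p))\<^sup>2 \<le> (norm (x - (p + t *\<^sub>R v)))\<^sup>2"
      using D_le \<open>(norm (x - p))\<^sup>2 \<le> D\<close> by (meson order_trans)
    also have "\<dots> = (norm ((x - p) - t *\<^sub>R v))\<^sup>2" by (simp add: algebra_simps)
    also have "\<dots> = (norm (x - p))\<^sup>2 - 2 * t * inner v (x - p) + t\<^sup>2 * (norm v)\<^sup>2"
      unfolding power2_norm_eq_inner inner_diff_left inner_diff_right inner_scaleR_left inner_scaleR_right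
      by (simp add: inner_diff_right inner_diff_left inner_commute power2_eq_square algebra_simps)
    also have "\<dots> = (norm (x - p))\<^sup>2 - (inner v (x - p))\<^sup>2 / (norm v)\<^sup>2"
      using False by (simp add: t_def power2_eq_square)
    finally have "(inner v (x - p))\<^sup>2 / (norm v)\<^sup>2 \<le> 0" by simp
    then show ?thesis using False by (simp add: divide_le_0_iff)
  qed simp
  moreover have "x - p \<noteq> 0" using x pW by auto
  ultimately show thesis using that by blast
qed

lemma norm_scaleC: "norm (c *\<^sub>C x) = cmod c * norm (x :: 'a::complex_inner)"
proof -
  have "cinner (c *\<^sub>C x) (c *\<^sub>C x) = c * cnj c * cinner x x"
    using cinner_commute[of x "c *\<^sub>C x"] cinner_commute[of x x]
    by (simp add: cinner_scaleC_left)
  also have "\<dots> = complex_of_real ((cmod c)\<^sup>2) * cinner x x"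
    unfolding complex_norm_square ..
  finally have "(norm (c *\<^sub>C x))\<^sup>2 = (cmod c * norm x)\<^sup>2"
    by (simp add: power2_norm_eq_inner inner_eq_Re_cinner power_mult_distrib)
  then show ?thesis by (simp add: power2_eq_iff_nonneg)
qed

text \<open>Rotating x by the conjugate phase of the inner product makes that product real and
  nonnegative, which reduces the claim to the real inequality.\<close>

lemma norm_cinner_le: "cmod (cinner x y) \<le> norm x * norm (y :: 'a::complex_inner)"
proof -
  let ?z = "cinner x y"
  have "cmod (sgn ?z) \<le> 1" by (simp add: norm_sgn)
  have "cnj (sgn ?z) * ?z = (?z * cnj ?z) / complex_of_real (cmod ?z)"
    by (simp add: sgn_eq)
  also have "\<dots> = complex_of_real (cmod ?z)"
    unfolding complex_norm_square[symmetric] by (simp add: power2_eq_square)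
  finally have "cmod ?z = Re (cinner (cnj (sgn ?z) *\<^sub>C x) y)"
    by (simp add: cinner_scaleC_left)
  also have "\<dots> \<le> norm (cnj (sgn ?z) *\<^sub>C x) * norm y"
    unfolding inner_eq_Re_cinner[symmetric] by (rule norm_cauchy_schwarz)
  also have "\<dots> \<le> 1 * norm x * norm y"
    unfolding norm_scaleC using \<open>cmod (sgn ?z) \<le> 1\<close>
    by (intro mult_right_mono) auto
  finally show ?thesis by simp
qed

section \<open>Multiplication by an indicator, as an orthogonal projection\<close>

definition chi :: "real set \<Rightarrow> l2 \<Rightarrow> l2" where
  "chi S v = abs_l2 (\<lambda>x. indicator S x * rep_l2 v x)"

lemma square_integrable_indicator:
  assumes S [measurable]: "S \<in> sets \<mu>" and f: "square_integrable f"
  shows "square_integrable (\<lambda>x. indicator S x * f x)"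
proof -
  have [measurable]: "f \<in> borel_measurable \<mu>" using f by (simp add: square_integrable_def)
  have "integrable \<mu> (\<lambda>x. (cmod (indicator S x * f x))\<^sup>2)"
  proof (rule Bochner_Integration.integrable_bound)
    show "integrable \<mu> (\<lambda>x. (cmod (f x))\<^sup>2)" using f by (simp add: square_integrable_def)
    show "(\<lambda>x. (cmod (indicator S x * f x))\<^sup>2) \<in> borel_measurable \<mu>" by measurable
  qed (auto simp: indicator_def)
  then show ?thesis by (simp add: square_integrable_def)
qed

lemma rep_chi:
  assumes "S \<in> sets \<mu>"
  shows "AE x in \<mu>. rep_l2 (chi S v) x = indicator S x * rep_l2 v x"
  unfolding chi_def by (rule rep_abs_l2[OF square_integrable_indicator[OF assms square_integrable_rep]])

lemma rep_l2_measurable: "rep_l2 v \<in> borel_measurable \<mu>"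
  using square_integrable_rep[of v] by (simp add: square_integrable_def)

lemma integrable_rep_cnj: "integrable \<mu> (\<lambda>x. rep_l2 v x * cnj (rep_l2 w x))"
  by (rule integrable_mult_cnj[OF square_integrable_rep square_integrable_rep])

lemma cinner_chi_left:
  assumes S [measurable]: "S \<in> sets \<mu>"
  shows "cinner (chi S v) w = (\<integral>x. indicator S x * (rep_l2 v x * cnj (rep_l2 w x)) \<partial>\<mu>)"
  unfolding cinner_l2_eq
proof (rule integral_cong_AE)
  note [measurable] = borel_measurable_integrable[OF integrable_rep_cnj]
  show "(\<lambda>x. rep_l2 (chi S v) x * cnj (rep_l2 w x)) \<in> borel_measurable \<mu>" by measurable
  show "(\<lambda>x. indicator S x * (rep_l2 v x * cnj (rep_l2 w x))) \<in> borel_measurable \<mu>" by measurable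
  show "AE x in \<mu>. rep_l2 (chi S v) x * cnj (rep_l2 w x)
      = indicator S x * (rep_l2 v x * cnj (rep_l2 w x))"
    using rep_chi[OF S, of v] by eventually_elim simp
qed

lemma cinner_chi_right:
  assumes S: "S \<in> sets \<mu>"
  shows "cinner v (chi S w) = cinner (chi S v) w"
  unfolding cinner_chi_left[OF S] unfolding cinner_l2_eq
proof (rule integral_cong_AE)
  note [measurable] = borel_measurable_integrable[OF integrable_rep_cnj] S
  show "(\<lambda>x. rep_l2 v x * cnj (rep_l2 (chi S w) x)) \<in> borel_measurable \<mu>" by measurable
  show "(\<lambda>x. indicator S x * (rep_l2 v x * cnj (rep_l2 w x))) \<in> borel_measurable \<mu>" by measurable
  show "AE x in \<mu>. rep_l2 v x * cnj (rep_l2 (chi S w) x)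
      = indicator S x * (rep_l2 v x * cnj (rep_l2 w x))"
    using rep_chi[OF S, of w] by eventually_elim (simp add: indicator_def)
qed

lemma norm_chi_sq:
  assumes S [measurable]: "S \<in> sets \<mu>"
  shows "(norm (chi S v))\<^sup>2 = (\<integral>x. indicator S x * (cmod (rep_l2 v x))\<^sup>2 \<partial>\<mu>)"
  unfolding norm_l2_eq
proof (rule integral_cong_AE)
  note [measurable] = rep_l2_measurable
  show "(\<lambda>x. (cmod (rep_l2 (chi S v) x))\<^sup>2) \<in> borel_measurable \<mu>" by measurable
  show "(\<lambda>x. indicator S x * (cmod (rep_l2 v x))\<^sup>2) \<in> borel_measurable \<mu>" by measurable
  show "AE x in \<mu>. (cmod (rep_l2 (chi S v) x))\<^sup>2 = indicator S x * (cmod (rep_l2 v x))\<^sup>2"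
    using rep_chi[OF S, of v] by eventually_elim (simp add: indicator_def)
qed

lemma norm_chi_le:
  assumes S [measurable]: "S \<in> sets \<mu>"
  shows "norm (chi S v) \<le> norm v"
proof -
  note [measurable] = rep_l2_measurable
  have int: "integrable \<mu> (\<lambda>x. (cmod (rep_l2 v x))\<^sup>2)"
    using square_integrable_rep by (simp add: square_integrable_def)
  have "(norm (chi S v))\<^sup>2 \<le> (norm v)\<^sup>2"
    unfolding norm_chi_sq[OF S] unfolding norm_l2_eq
    by (rule integral_mono'[OF int]) (simp_all add: indicator_def)
  then show ?thesis by (rule power2_le_imp_le) simp
qed

text \<open>The sets need not decrease: dominated convergence only needs almost every point to leave
  them eventually.\<close>

lemma norm_chi_tendsto_zero:
  assumes S: "\<And>n. S n \<in> sets \<mu>" and out: "AE x in \<mu>. \<forall>\<^sub>F n in sequentially. x \<notin> S n"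
  shows "(\<lambda>n. norm (chi (S n) v)) \<longlonglongrightarrow> 0"
proof -
  note [measurable] = rep_l2_measurable S
  have int: "integrable \<mu> (\<lambda>x. (cmod (rep_l2 v x))\<^sup>2)"
    using square_integrable_rep by (simp add: square_integrable_def)
  have "(\<lambda>n. \<integral>x. indicator (S n) x * (cmod (rep_l2 v x))\<^sup>2 \<partial>\<mu>) \<longlonglongrightarrow> (\<integral>x. 0 \<partial>\<mu>)"
  proof (rule integral_dominated_convergence[OF _ _ int])
    show "AE x in \<mu>. (\<lambda>n. indicator (S n) x * (cmod (rep_l2 v x))\<^sup>2) \<longlonglongrightarrow> 0"
      using out
    proof eventually_elim
      case (elim x)
      show ?case
        by (rule tendsto_eventually) (use elim in \<open>eventually_elim, simp\<close>)
    qed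
  qed (auto simp: indicator_def)
  then have "(\<lambda>n. (norm (chi (S n) v))\<^sup>2) \<longlonglongrightarrow> 0" by (simp add: norm_chi_sq[OF S])
  then have "(\<lambda>n. sqrt ((norm (chi (S n) v))\<^sup>2)) \<longlonglongrightarrow> sqrt 0" by (rule tendsto_real_sqrt)
  then show ?thesis by simp
qed

lemma chi_idem:
  assumes S: "S \<in> sets \<mu>"
  shows "chi S (chi S v) = chi S v"
  by (rule l2_eqI)
    (use rep_chi[OF S, of v] rep_chi[OF S, of "chi S v"]
      in \<open>eventually_elim, simp add: indicator_def\<close>)

lemma chi_split:
  assumes S: "S \<in> sets \<mu>" "T \<in> sets \<mu>" "S \<inter> T = {}"
  shows "chi (S \<union> T) v = chi S v + chi T v"
proof (rule l2_eqI)
  show "AE x in \<mu>. rep_l2 (chi (S \<union> T) v) x = rep_l2 (chi S v + chi T v) x"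
    using rep_chi[OF S(1), of v] rep_chi[OF S(2), of v] rep_chi[OF sets.Un[OF S(1,2)], of v]
      rep_l2_add[of "chi S v" "chi T v"]
    by eventually_elim (use S(3) in \<open>auto simp: indicator_def\<close>)
qed

lemma chi_AE_UNIV:
  assumes "S \<in> sets \<mu>" "AE x in \<mu>. x \<in> S"
  shows "chi S v = v"
  by (rule l2_eqI) (use rep_chi[OF assms(1), of v] assms(2) in \<open>eventually_elim, simp\<close>)

text \<open>Transport of supports: a vector supported in \<open>T\<close> becomes one supported in
  \<open>S\<close> when \<open>T\<close> is the preimage of \<open>S\<close>.\<close>

lemma koopman_chi:
  assumes g: "g \<in> thompson_carrier" and S: "S \<in> sets \<mu>" and T: "T \<in> sets \<mu>"
    and gT: "\<And>x. x \<in> {0..1} \<Longrightarrow> g x \<in> S \<longleftrightarrow> x \<in> T"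
  shows "koopman_rep s g (chi T v) = chi S (koopman_rep s g v)"
proof (rule l2_eqI)
  show "AE x in \<mu>. rep_l2 (koopman_rep s g (chi T v)) x = rep_l2 (chi S (koopman_rep s g v)) x"
    using rep_koopman[OF g, of s "chi T v"] rep_koopman[OF g, of s v]
      rep_chi[OF S, of "koopman_rep s g v"]
      AE_thompson[OF tinv_in_thompson_carrier[OF g] rep_chi[OF T, of v]] AE_space[of \<mu>]
  proof eventually_elim
    case (elim x)
    then have x: "x \<in> {0..1}" by (simp add: space_unit)
    have "tinv g x \<in> T \<longleftrightarrow> x \<in> S"
      using gT[of "tinv g x"] thompson_carrier_mem[OF tinv_in_thompson_carrier[OF g] x]
        tinv_right[OF g x] by simp
    with elim show ?case by (simp add: indicator_def)
  qed
qed

text \<open>By injectivity a point outside \<open>S\<close> is not moved into \<open>S\<close> by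
  the inverse, and on \<open>S\<close> both the point and the factor are unchanged since the
  derivative is 1 there.\<close>

lemma koopman_chi_fixed:
  assumes g: "g \<in> thompson_carrier" and S: "S \<in> sets \<mu>" and fixed: "\<And>x. x \<in> S \<Longrightarrow> g x = x"
  shows "koopman_rep s g (chi S v) = chi S v"
proof (rule l2_eqI)
  have "AE x in \<mu>. x \<in> S \<longrightarrow> jac g x = 1" by (rule jac_local[OF g S fixed])
  then show "AE x in \<mu>. rep_l2 (koopman_rep s g (chi S v)) x = rep_l2 (chi S v) x"
    using rep_koopman[OF g, of s "chi S v"] rep_chi[OF S, of v]
      AE_thompson[OF tinv_in_thompson_carrier[OF g] rep_chi[OF S, of v]] AE_space[of \<mu>]
  proof eventually_elim
    case (elim x)
    then have x: "x \<in> {0..1}" by (simp add: space_unit)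
    show ?case
    proof (cases "x \<in> S")
      case True
      then have "tinv g x = x" using tinv_left[OF g x] fixed[of x] by simp
      with True elim show ?thesis by simp
    next
      case False
      then have "tinv g x \<notin> S" using fixed[of "tinv g x"] tinv_right[OF g x] by auto
      with False elim show ?thesis by simp
    qed
  qed
qed

lemma koopman_norm: "g \<in> thompson_carrier \<Longrightarrow> norm (koopman_rep s g v) = norm v"
  by (simp add: norm_eq_sqrt_inner inner_eq_Re_cinner koopman_cinner)

lemma AE_neq: "AE x in \<mu>. x \<noteq> c"
proof -
  have "AE x in lborel. x \<noteq> c" by (rule AE_lborel_singleton)
  then show ?thesis by (subst AE_restrict_space_iff) auto
qed

text \<open>The core of the proof. Orthogonality to the orbit is applied to the elements \<gamma> n,
  which fix (c, 1] and carry [0, c - e n] onto [0, e n]. The inner product over (c, 1] is then minus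
  the sum of two terms that tend to 0.\<close>

lemma koopman_orthogonal_localize:
  assumes orth: "\<And>g. g \<in> thompson_carrier \<Longrightarrow> cinner (koopman_rep s g u) w = 0"
    and c: "c \<in> dyadic" "0 \<le> c" "c \<le> 1"
  shows "cinner (chi {c<..1} u) w = 0"
\<comment> \<open>There is no interval to squeeze when c = 0, but then the indicator is 1 almost
  everywhere.\<close>
proof (cases "c = 0")
  case True
  have "AE x in \<mu>. x \<in> {c<..1}"
    using AE_space[of \<mu>] AE_neq[of 0] by eventually_elim (simp add: space_unit True)
  then have "chi {c<..1} u = u" using c by (intro chi_AE_UNIV) (auto simp: sets_unit_iff)
  then show ?thesis using orth[OF thompson_carrier_id] by (simp only: koopman_id)
next
  case False
  with c have c0: "0 < c" by simp
  define e where "e n = c / 2 ^ Suc n" for n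
  have e: "0 < e n" "e n \<le> c / 2" for n
    using c0 by (auto simp: e_def field_simps)
  have e_lim: "e \<longlonglongrightarrow> 0"
    unfolding e_def by (intro LIMSEQ_Suc[OF LIMSEQ_divide_realpow_zero]) simp
  have sq: "squeeze (c / 4) c \<in> thompson_carrier"
    using c c0 dyadic_half[OF dyadic_half[OF c(1)]] by (intro squeeze_in_thompson_carrier) auto
  define \<gamma> where "\<gamma> n = cpow (squeeze (c / 4) c) (n + n)" for n
  have \<gamma>: "\<gamma> n \<in> thompson_carrier" for n
    unfolding \<gamma>_def by (rule cpow_in_thompson_carrier[OF sq])
  have \<gamma>_fix: "\<gamma> n x = x" if "x \<in> {c<..1}" for n x
    using that c0 cpow_eq_funpow[OF sq, of x] by (simp add: \<gamma>_def funpow_squeeze_fixed)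
  have \<gamma>_push: "\<gamma> n (c - e n) = e n" for n
  proof -
    have "c - e n \<in> {0..1}" using c e[of n] by auto
    then have "\<gamma> n (c - e n) = (squeeze (c / 4) c ^^ (n + n)) (c - e n)"
      unfolding \<gamma>_def by (rule cpow_eq_funpow[OF sq])
    also have "\<dots> = e n" unfolding e_def by (rule funpow_squeeze_push[OF c0 c(3)])
    finally show ?thesis .
  qed
  have mono: "strict_mono_on {0..1} (\<gamma> n)" for n
    by (rule thompson_carrier_strict_mono[OF \<gamma>])
  \<comment> \<open>Monotonicity together with the value at the single point c - e n determines
    which points land in [0, e n].\<close>
  have in_iff: "\<gamma> n x \<in> {0..e n} \<longleftrightarrow> x \<in> {0..c - e n}" if x: "x \<in> {0..1}" for n x
  proof -
    have "\<gamma> n x \<le> \<gamma> n (c - e n) \<longleftrightarrow> x \<le> c - e n"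
      by (rule strict_mono_on_less_eq[OF mono x]) (use e[of n] c in auto)
    then show ?thesis
      using \<gamma>_push thompson_carrier_mem[OF \<gamma> x, of n] x by auto
  qed
  have sets: "{c<..1} \<in> sets \<mu>" "{0..c - e n} \<in> sets \<mu>" "{c - e n<..c} \<in> sets \<mu>" "{0..e n} \<in> sets \<mu>" for n
    using c e[of n] by (auto simp: sets_unit_iff)
  have "cmod (cinner (chi {c<..1} u) w)
      \<le> norm u * norm (chi {0..e n} w) + norm (chi {c - e n<..c} u) * norm w" for n
  proof -
    let ?\<pi> = "koopman_rep s (\<gamma> n)"
    let ?p = "chi {0..c - e n} u" and ?q = "chi {c - e n<..c} u"
    have "{c<..1} \<union> ({0..c - e n} \<union> {c - e n<..c}) = {0..1}" using c e[of n] by auto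
    then have "chi ({c<..1} \<union> ({0..c - e n} \<union> {c - e n<..c})) u = u"
      using AE_space[of \<mu>] by (intro chi_AE_UNIV) (auto simp: sets_unit_iff space_unit)
    moreover have "chi ({c<..1} \<union> ({0..c - e n} \<union> {c - e n<..c})) u = chi {c<..1} u + (?p + ?q)"
    proof -
      have d: "{c<..1} \<inter> ({0..c - e n} \<union> {c - e n<..c}) = {}" "{0..c - e n} \<inter> {c - e n<..c} = {}"
        using e[of n] by auto
      show ?thesis
        unfolding chi_split[OF sets(1) sets.Un[OF sets(2,3)] d(1)] chi_split[OF sets(2,3) d(2)] ..
    qed
    ultimately have "?\<pi> u = ?\<pi> (chi {c<..1} u) + (?\<pi> ?p + ?\<pi> ?q)"
      using koopman_add[OF \<gamma>] by metis
    moreover have "?\<pi> (chi {c<..1} u) = chi {c<..1} u"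
      by (rule koopman_chi_fixed[OF \<gamma> sets(1) \<gamma>_fix])
    ultimately have sum: "0 = cinner (chi {c<..1} u) w + (cinner (?\<pi> ?p) w + cinner (?\<pi> ?q) w)"
      using orth[OF \<gamma>[of n]] by (simp add: cinner_add_left)
    \<comment> \<open>The image of \<open>?p\<close> is supported in [0, e n]; moving the projection
      to the other side of the inner product restricts \<open>w\<close> to that shrinking
      interval.\<close>
    have "?\<pi> ?p = chi {0..e n} (?\<pi> ?p)"
      using koopman_chi[OF \<gamma> sets(4) sets(2) in_iff, where v = ?p and s = s] chi_idem[OF sets(2)] by metis
    then have "cinner (?\<pi> ?p) w = cinner (?\<pi> ?p) (chi {0..e n} w)"
      using cinner_chi_right[OF sets(4)] by metis
    then have "cmod (cinner (?\<pi> ?p) w) \<le> norm (?\<pi> ?p) * norm (chi {0..e n} w)"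
      using norm_cinner_le by metis
    also have "\<dots> \<le> norm u * norm (chi {0..e n} w)"
      unfolding koopman_norm[OF \<gamma>] by (intro mult_right_mono norm_chi_le sets) auto
    finally have "cmod (cinner (?\<pi> ?p) w) \<le> norm u * norm (chi {0..e n} w)" .
    moreover have "cmod (cinner (?\<pi> ?q) w) \<le> norm ?q * norm w"
      using norm_cinner_le[of "?\<pi> ?q" w] unfolding koopman_norm[OF \<gamma>] .
    moreover have "cinner (chi {c<..1} u) w = - (cinner (?\<pi> ?p) w + cinner (?\<pi> ?q) w)"
      using sum[symmetric] by (simp only: eq_neg_iff_add_eq_0)
    then have "cmod (cinner (chi {c<..1} u) w) \<le> cmod (cinner (?\<pi> ?p) w) + cmod (cinner (?\<pi> ?q) w)"
      by (simp only: norm_minus_cancel norm_triangle_ineq)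
    ultimately show ?thesis by linarith
  qed
  moreover have "(\<lambda>n. norm u * norm (chi {0..e n} w) + norm (chi {c - e n<..c} u) * norm w)
      \<longlonglongrightarrow> norm u * 0 + 0 * norm w"
  proof (intro tendsto_intros norm_chi_tendsto_zero sets)
    show "AE x in \<mu>. \<forall>\<^sub>F n in sequentially. x \<notin> {0..e n}"
      using AE_neq[of 0] AE_space[of \<mu>]
    proof eventually_elim
      case (elim x)
      then have "0 < x" by (simp add: space_unit)
      then have "\<forall>\<^sub>F n in sequentially. e n < x" by (rule order_tendstoD(2)[OF e_lim])
      then show ?case by eventually_elim simp
    qed
    show "AE x in \<mu>. \<forall>\<^sub>F n in sequentially. x \<notin> {c - e n<..c}"
      using AE_neq[of c]
    proof eventually_elim
      case (elim x)
      show ?case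
      proof (cases "x < c")
        case True
        then have "\<forall>\<^sub>F n in sequentially. e n < c - x" by (intro order_tendstoD(2)[OF e_lim]) simp
        then show ?thesis by eventually_elim simp
      next
        case False
        with elim show ?thesis by simp
      qed
    qed
  qed
  ultimately have "cmod (cinner (chi {c<..1} u) w) \<le> norm u * 0 + 0 * norm w"
    by (intro LIMSEQ_le_const) auto
  then show ?thesis by simp
qed

section \<open>Functions determined by their integrals over dyadic intervals\<close>

lemma indicator_measurable_unit:
  "B \<in> sets borel \<Longrightarrow> (indicator B :: real \<Rightarrow> 'a::{zero_neq_one, topological_space}) \<in> borel_measurable \<mu>"
  by (intro measurable_restrict_space1 borel_measurable_indicator) simp

text \<open>Dyadic end points are dense, so the integrals over all half-lines vanish. The positive
  and negative parts then define finite measures that agree on half-lines, hence everywhere, and so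
  have equal densities.\<close>

lemma AE_zero_of_dyadic_integrals_real:
  fixes h :: "real \<Rightarrow> real"
  assumes h: "integrable \<mu> h"
    and zero: "\<And>c. c \<in> dyadic \<Longrightarrow> 0 \<le> c \<Longrightarrow> c \<le> 1 \<Longrightarrow> (\<integral>x. indicator {c<..1} x * h x \<partial>\<mu>) = 0"
  shows "AE x in \<mu>. h x = 0"
proof -
  have hm [measurable]: "h \<in> borel_measurable \<mu>" using h by simp
  have zero_real: "(\<integral>x. indicator {a<..1} x * h x \<partial>\<mu>) = 0" if a: "0 \<le> a" "a \<le> 1" for a
  proof -
    \<comment> \<open>Rounding up matters: approaching \<open>a\<close> from above makes the
      indicators of the half-open intervals converge at every point, including x = a.\<close>
    define c :: "nat \<Rightarrow> real" where "c n = of_int \<lceil>a * 2 ^ n\<rceil> / 2 ^ n" for n :: nat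
    have c: "c n \<in> dyadic" "a \<le> c n" "c n \<le> a + 1 / 2 ^ n" "c n \<le> 1" for n
    proof -
      show "c n \<in> dyadic" unfolding c_def by (rule dyadic_of_int)
      have "a * 2 ^ n \<le> of_int \<lceil>a * 2 ^ n\<rceil>" "of_int \<lceil>a * 2 ^ n\<rceil> \<le> a * 2 ^ n + 1"
        by linarith+
      then show "a \<le> c n" "c n \<le> a + 1 / 2 ^ n"
        by (simp_all add: c_def field_simps)
      have "\<lceil>a * 2 ^ n\<rceil> \<le> 2 ^ n" using a(2) by (simp add: ceiling_le_iff)
      then have "of_int \<lceil>a * 2 ^ n\<rceil> \<le> (of_int (2 ^ n) :: real)" by (simp only: of_int_le_iff)
      then show "c n \<le> 1" by (simp add: c_def)
    qed
    have lim: "(\<lambda>n. a + 1 / 2 ^ n) \<longlonglongrightarrow> a + 0"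
      by (intro tendsto_intros LIMSEQ_divide_realpow_zero) simp
    have "(\<lambda>n. \<integral>x. indicator {c n<..1} x * h x \<partial>\<mu>) \<longlonglongrightarrow> (\<integral>x. indicator {a<..1} x * h x \<partial>\<mu>)"
    proof (rule integral_dominated_convergence[where w = "\<lambda>x. norm (h x)"])
      have im: "(\<lambda>x. indicator {b<..1} x * h x) \<in> borel_measurable \<mu>" for b
        by (intro borel_measurable_times hm indicator_measurable_unit) simp
      show "(\<lambda>x. indicator {a<..1} x * h x) \<in> borel_measurable \<mu>" by (rule im)
      show "(\<lambda>x. indicator {c n<..1} x * h x) \<in> borel_measurable \<mu>" for n by (rule im)
      show "AE x in \<mu>. (\<lambda>n. indicator {c n<..1} x * h x) \<longlonglongrightarrow> indicator {a<..1} x * h x"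
      proof (rule AE_I2)
        fix x :: real
        have ev: "\<forall>\<^sub>F n in sequentially. indicator {c n<..1} x = (indicator {a<..1} x :: real)"
        proof (cases "a < x")
          case True
          have "\<forall>\<^sub>F n in sequentially. a + 1 / 2 ^ n < x"
            using order_tendstoD(2)[OF lim] True by simp
          then show ?thesis
          proof eventually_elim
            case (elim n)
            then show ?case using c(3)[of n] True by (simp add: indicator_def)
          qed
        next
          case False
          then have "indicator {c n<..1} x = (indicator {a<..1} x :: real)" for n
            using c(2)[of n] by (simp add: indicator_def)
          then show ?thesis by simp
        qed
        show "(\<lambda>n. indicator {c n<..1} x * h x) \<longlonglongrightarrow> indicator {a<..1} x * h x"
          by (rule tendsto_eventually, rule eventually_mono[OF ev]) simp
      qed
    qed (use h in \<open>auto simp: indicator_def\<close>)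
    moreover have "(\<integral>x. indicator {c n<..1} x * h x \<partial>\<mu>) = 0" for n
      using c[of n] a by (intro zero) auto
    ultimately show ?thesis by (simp add: LIMSEQ_const_iff)
  qed
  define H where "H = (\<lambda>x. indicator {0..1} x * h x)"
  have H: "integrable lborel H"
    using h by (simp add: integrable_restrict_space H_def)
  then have Hm [measurable]: "H \<in> borel_measurable borel" by simp
  have H_zero: "(\<integral>x. indicator {a<..} x * H x \<partial>lborel) = 0" for a
  proof -
    have "(\<integral>x. indicator {a<..} x * H x \<partial>lborel) = (\<integral>x. indicator {a<..} x * h x \<partial>\<mu>)"
      by (subst integral_restrict_space) (auto simp: H_def mult_ac)
    \<comment> \<open>The end point is clamped to [0, 1]. For a < 0 this changes the indicator at x
      = 0, whence equality only almost everywhere.\<close>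
    also have "\<dots> = (\<integral>x. indicator {min 1 (max a 0)<..1} x * h x \<partial>\<mu>)"
    proof (rule integral_cong_AE)
      have im: "(\<lambda>x. indicator B x * h x) \<in> borel_measurable \<mu>" if "B \<in> sets borel" for B
        using that by (intro borel_measurable_times hm indicator_measurable_unit)
      show "(\<lambda>x. indicator {a<..} x * h x) \<in> borel_measurable \<mu>"
        "(\<lambda>x. indicator {min 1 (max a 0)<..1} x * h x) \<in> borel_measurable \<mu>"
        by (intro im; simp)+
      show "AE x in \<mu>. indicator {a<..} x * h x = indicator {min 1 (max a 0)<..1} x * h x"
        using AE_space[of \<mu>] AE_neq[of 0]
        by eventually_elim (auto simp: space_unit indicator_def)
    qed
    also have "\<dots> = 0" by (rule zero_real) auto
    finally show ?thesis .
  qed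
  define f where "f = (\<lambda>x. max 0 (H x))"
  define g where "g = (\<lambda>x. max 0 (- H x))"
  have fg: "integrable lborel f" "integrable lborel g" "\<And>x. 0 \<le> f x" "\<And>x. 0 \<le> g x"
    using H by (auto simp: f_def g_def)
  have [measurable]: "f \<in> borel_measurable borel" "g \<in> borel_measurable borel"
    unfolding f_def g_def by measurable
  have int: "integrable lborel (\<lambda>x. indicator {a<..} x * F x)" if "integrable lborel F" for a and F :: "real \<Rightarrow> real"
  proof -
    have "integrable lborel (\<lambda>x. F x * indicator {a<..} x)"
      by (rule integrable_real_mult_indicator[OF _ that]) simp
    then show ?thesis by (simp add: mult.commute)
  qed
  have em: "emeasure (density lborel (\<lambda>x. ennreal (F x))) {a<..}
      = ennreal (\<integral>x. indicator {a<..} x * F x \<partial>lborel)"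
    if F: "integrable lborel F" "\<And>x. 0 \<le> F x" for a and F :: "real \<Rightarrow> real"
  proof -
    have "emeasure (density lborel (\<lambda>x. ennreal (F x))) {a<..}
        = (\<integral>\<^sup>+x. ennreal (F x) * indicator {a<..} x \<partial>lborel)"
      using borel_measurable_integrable[OF F(1)] by (intro emeasure_density) simp_all
    also have "\<dots> = (\<integral>\<^sup>+x. ennreal (indicator {a<..} x * F x) \<partial>lborel)"
      by (rule nn_integral_cong) (simp add: indicator_def)
    also have "\<dots> = ennreal (\<integral>x. indicator {a<..} x * F x \<partial>lborel)"
      by (rule nn_integral_eq_integral[OF int[OF F(1)]]) (simp add: F(2))
    finally show ?thesis .
  qed
  have "density lborel (\<lambda>x. ennreal (f x)) = density lborel (\<lambda>x. ennreal (g x))"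
  proof (rule measure_eqI_lessThan)
    fix a
    show "emeasure (density lborel (\<lambda>x. ennreal (f x))) {a<..} < \<infinity>"
      unfolding em[OF fg(1,3)] by simp
    have "(\<integral>x. indicator {a<..} x * f x \<partial>lborel) - (\<integral>x. indicator {a<..} x * g x \<partial>lborel)
        = (\<integral>x. indicator {a<..} x * f x - indicator {a<..} x * g x \<partial>lborel)"
      by (rule Bochner_Integration.integral_diff[symmetric]) (rule int fg)+
    also have "\<dots> = (\<integral>x. indicator {a<..} x * H x \<partial>lborel)"
      by (rule Bochner_Integration.integral_cong) (auto simp: f_def g_def max_def indicator_def)
    finally show "emeasure (density lborel (\<lambda>x. ennreal (f x))) {a<..}
        = emeasure (density lborel (\<lambda>x. ennreal (g x))) {a<..}"
      unfolding em[OF fg(1,3)] em[OF fg(2,4)] using H_zero by simp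
  qed auto
  then have "AE x in lborel. ennreal (f x) = ennreal (g x)"
    by (subst (asm) sigma_finite_measure.density_unique_iff[OF sigma_finite_lborel]) auto
  then have "AE x in lborel. x \<in> {0..1} \<longrightarrow> h x = 0"
    by eventually_elim (auto simp: f_def g_def H_def max_def split: if_splits)
  then show ?thesis by (subst AE_restrict_space_iff) auto
qed

lemma AE_zero_of_dyadic_integrals:
  fixes h :: "real \<Rightarrow> complex"
  assumes h: "integrable \<mu> h"
    and zero: "\<And>c. c \<in> dyadic \<Longrightarrow> 0 \<le> c \<Longrightarrow> c \<le> 1 \<Longrightarrow> (\<integral>x. indicator {c<..1} x * h x \<partial>\<mu>) = 0"
  shows "AE x in \<mu>. h x = 0"
proof -
  have int: "integrable \<mu> (\<lambda>x. indicator {c<..1} x * h x)" for c :: real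
  proof (rule Bochner_Integration.integrable_bound[OF h])
    have hm: "h \<in> borel_measurable \<mu>" using h by simp
    show "(\<lambda>x. indicator {c<..1} x * h x) \<in> borel_measurable \<mu>"
      by (intro borel_measurable_times hm indicator_measurable_unit) simp
  qed (auto simp: indicator_def)
  have "AE x in \<mu>. Re (h x) = 0"
  proof (rule AE_zero_of_dyadic_integrals_real)
    fix c :: real assume c: "c \<in> dyadic" "0 \<le> c" "c \<le> 1"
    have "(\<integral>x. indicator {c<..1} x * Re (h x) \<partial>\<mu>) = (\<integral>x. Re (indicator {c<..1} x * h x) \<partial>\<mu>)"
      by (rule Bochner_Integration.integral_cong) (auto simp: indicator_def)
    also have "\<dots> = 0" using integral_Re[OF int[of c]] zero[OF c] by simp
    finally show "(\<integral>x. indicator {c<..1} x * Re (h x) \<partial>\<mu>) = 0" .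
  qed (use h in simp)
  moreover have "AE x in \<mu>. Im (h x) = 0"
  proof (rule AE_zero_of_dyadic_integrals_real)
    fix c :: real assume c: "c \<in> dyadic" "0 \<le> c" "c \<le> 1"
    have "(\<integral>x. indicator {c<..1} x * Im (h x) \<partial>\<mu>) = (\<integral>x. Im (indicator {c<..1} x * h x) \<partial>\<mu>)"
      by (rule Bochner_Integration.integral_cong) (auto simp: indicator_def)
    also have "\<dots> = 0" using integral_Im[OF int[of c]] zero[OF c] by simp
    finally show "(\<integral>x. indicator {c<..1} x * Im (h x) \<partial>\<mu>) = 0" .
  qed (use h in simp)
  ultimately show ?thesis by eventually_elim (simp add: complex_eq_iff)
qed


section \<open>Irreducibility\<close>

text \<open>The vector \<open>koopman_rep s g u\<close> has the same orbit as \<open>u\<close>, so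
  localization applies to it as well. The factor in front of \<open>u\<close> can be cancelled
  because the derivative is positive almost everywhere.\<close>

lemma koopman_orthogonal_AE:
  assumes orth: "\<And>g. g \<in> thompson_carrier \<Longrightarrow> cinner (koopman_rep s g u) w = 0"
    and g: "g \<in> thompson_carrier"
  shows "AE x in \<mu>. rep_l2 u (tinv g x) = 0 \<or> rep_l2 w x = 0"
proof -
  let ?u = "koopman_rep s g u"
  have orth': "cinner (koopman_rep s h ?u) w = 0" if h: "h \<in> thompson_carrier" for h
    using orth[OF thompson_carrier_compose[OF h g]] by (simp add: koopman_compose[OF h g])
  have "AE x in \<mu>. rep_l2 ?u x * cnj (rep_l2 w x) = 0"
  proof (rule AE_zero_of_dyadic_integrals[OF integrable_rep_cnj])
    fix c :: real assume c: "c \<in> dyadic" "0 \<le> c" "c \<le> 1"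
    have "{c<..1} \<in> sets \<mu>" using c by (auto simp: sets_unit_iff)
    then show "(\<integral>x. indicator {c<..1} x * (rep_l2 ?u x * cnj (rep_l2 w x)) \<partial>\<mu>) = 0"
      using koopman_orthogonal_localize[OF orth' c] by (simp add: cinner_chi_left)
  qed
  then show ?thesis
    using rep_koopman[OF g, of s u] jac_pos[OF g] by eventually_elim auto
qed

text \<open>A map of [0, 1] cannot translate near both end points, hence the margin
  \<open>d\<close>. Inside it, a power of a squeezing map with c = 1 and step h < d is a genuine
  translation.\<close>

lemma local_translation:
  assumes t: "t \<in> dyadic" and d: "0 < d"
  obtains g where "g \<in> thompson_carrier"
    "\<And>x. x \<in> {d..1 - d} \<Longrightarrow> x + t \<in> {d..1 - d} \<Longrightarrow> tinv g x = x + t"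
proof -
  obtain a :: int and m :: nat where am: "t = of_int a / 2 ^ m"
    using t by (auto simp: dyadic_def)
  \<comment> \<open>With step h = 1 / 2^(m+n), exactly this many steps add up to the absolute value
    of t, however fine the step is made.\<close>
  define k where "k n = nat \<bar>a\<bar> * 2 ^ n" for n
  obtain n :: nat where n: "1 / 2 ^ n < min d (1 / 3)"
    using d real_arch_pow_inv[of "min d (1 / 3)" "1 / 2"] by (auto simp: power_one_over)
  define h :: real where "h = 1 / 2 ^ (m + n)"
  have h: "0 < h" "h \<in> dyadic" "h \<le> 1 / 2 ^ n" "real (k n) * h = \<bar>t\<bar>"
    using dyadic_of_int[of 1 "m + n"]
    by (auto simp: h_def k_def am power_add field_simps)
  have h': "h < d" "3 * h \<le> 1" using h(3) n by linarith+
  have one: "1 \<in> dyadic" using dyadic_of_int[of 1 0] by simp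
  have sq: "squeeze h 1 \<in> thompson_carrier"
    by (rule squeeze_in_thompson_carrier) (use h h' one in auto)
  define \<gamma> where "\<gamma> = cpow (squeeze h 1) (k n)"
  have \<gamma>: "\<gamma> \<in> thompson_carrier" unfolding \<gamma>_def by (rule cpow_in_thompson_carrier[OF sq])
  have shift: "\<gamma> x = x - \<bar>t\<bar>" if "\<bar>t\<bar> + h \<le> x" "x \<le> 1 - h" for x
  proof -
    have "x \<in> {0..1}" using that h by auto
    then have "\<gamma> x = (squeeze h 1 ^^ k n) x"
      unfolding \<gamma>_def by (rule cpow_eq_funpow[OF sq])
    also have "\<dots> = x - real (k n) * h"
      by (rule funpow_squeeze_shift[OF h(1) _ that(2)]) (use that h(4) in \<open>simp add: algebra_simps\<close>)
    finally show ?thesis by (simp add: h(4))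
  qed
  show thesis
  \<comment> \<open>The power \<gamma> moves points to the left. Since the claim concerns the
    inverse of the element found, \<gamma> itself serves for t >= 0 and its inverse for t <
    0.\<close>
  proof (cases "0 \<le> t")
    case True
    show thesis
    proof (rule that[OF \<gamma>])
      fix x assume x: "x \<in> {d..1 - d}" "x + t \<in> {d..1 - d}"
      have "\<gamma> (x + t) = x" using shift[of "x + t"] x True h' by auto
      moreover have "x + t \<in> {0..1}" using x d by auto
      ultimately show "tinv \<gamma> x = x + t" using tinv_left[OF \<gamma>, of "x + t"] by simp
    qed
  next
    case False
    show thesis
    proof (rule that[OF tinv_in_thompson_carrier[OF \<gamma>]])
      fix x assume x: "x \<in> {d..1 - d}" "x + t \<in> {d..1 - d}"
      have "x \<in> {0..1}" using x d by auto
      then show "tinv (tinv \<gamma>) x = x + t"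
        using shift[of x] x False h' by (simp add: tinv_tinv[OF \<gamma>])
    qed
  qed
qed

text \<open>The group element depends on the margin, so the open interval is exhausted by the
  margins 1 / (n + 1); countably many exceptional null sets are united.\<close>

lemma koopman_orthogonal_translates:
  assumes orth: "\<And>g. g \<in> thompson_carrier \<Longrightarrow> cinner (koopman_rep s g u) w = 0"
    and t: "t \<in> dyadic"
  shows "AE x in \<mu>. x \<in> {0<..<1} \<longrightarrow> x + t \<in> {0<..<1} \<longrightarrow> rep_l2 u (x + t) = 0 \<or> rep_l2 w x = 0"
proof -
  have "AE x in \<mu>. x \<in> {d..1 - d} \<longrightarrow> x + t \<in> {d..1 - d} \<longrightarrow> rep_l2 u (x + t) = 0 \<or> rep_l2 w x = 0"
    if d: "0 < d" for d
  proof -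
    obtain g where g: "g \<in> thompson_carrier"
      "\<And>x. x \<in> {d..1 - d} \<Longrightarrow> x + t \<in> {d..1 - d} \<Longrightarrow> tinv g x = x + t"
      using local_translation[OF t d] by blast
    have "AE x in \<mu>. rep_l2 u (tinv g x) = 0 \<or> rep_l2 w x = 0"
      by (rule koopman_orthogonal_AE[OF orth g(1)])
    then show ?thesis
    proof eventually_elim
      case (elim x)
      then show ?case using g(2)[of x] by auto
    qed
  qed
  then have "AE x in \<mu>. \<forall>n. x \<in> {1 / real (Suc n)..1 - 1 / real (Suc n)}
      \<longrightarrow> x + t \<in> {1 / real (Suc n)..1 - 1 / real (Suc n)} \<longrightarrow> rep_l2 u (x + t) = 0 \<or> rep_l2 w x = 0"
    by (subst AE_all_countable) auto
  then show ?thesis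
  proof eventually_elim
    case (elim x)
    show ?case
    proof (intro impI)
      assume x: "x \<in> {0<..<1}" "x + t \<in> {0<..<1}"
      define d where "d = min (min x (1 - x)) (min (x + t) (1 - (x + t)))"
      have "0 < d" using x by (simp add: d_def)
      then obtain n where n: "1 / real (Suc n) < d"
        using nat_approx_posE by blast
      have "x \<in> {1 / real (Suc n)..1 - 1 / real (Suc n)}" "x + t \<in> {1 / real (Suc n)..1 - 1 / real (Suc n)}"
        using n unfolding d_def atLeastAtMost_iff by linarith+
      with elim show "rep_l2 u (x + t) = 0 \<or> rep_l2 w x = 0" by blast
    qed
  qed
qed

text \<open>
  Invariance under dyadic translations makes the measure of \<open>A \<inter> (0, c]\<close> proportional to \<open>c\<close> for
  dyadic \<open>c\<close>, so that the indicator of \<open>A\<close> is almost everywhere constant.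
\<close>

lemma dyadic_periodic_null_or_conull:
  assumes A [measurable]: "A \<in> sets borel"
    and per: "\<And>x t. t \<in> dyadic \<Longrightarrow> x + t \<in> A \<longleftrightarrow> x \<in> A"
  shows "(AE x in \<mu>. x \<notin> A) \<or> (AE x in \<mu>. x \<in> A)"
proof -
  define m where "m c = measure lborel (A \<inter> {0<..c})" for c
  have fm: "A \<inter> {a<..b} \<in> fmeasurable lborel" for a b :: real
    by (rule fmeasurableI2[OF fmeasurable_compact[OF compact_Icc[of a b]]]) auto
  have split: "m c = m b + measure lborel (A \<inter> {b<..c})" if "0 \<le> b" "b \<le> c" for b c
  proof -
    have "A \<inter> {0<..c} = (A \<inter> {0<..b}) \<union> (A \<inter> {b<..c})" using that by auto
    moreover have "(A \<inter> {0<..b}) \<inter> (A \<inter> {b<..c}) = {}" by auto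
    ultimately show ?thesis
      unfolding m_def using fm[of 0 b] fm[of b c]
      by (simp add: measure_Union fmeasurable_def less_top)
  qed
  have trans: "measure lborel (A \<inter> {b<..b + c}) = m c" if b: "b \<in> dyadic" for b c
  proof -
    have eq: "A \<inter> {b<..b + c} = (+) b ` (A \<inter> {0<..c})"
    proof (intro equalityI subsetI)
      fix x assume "x \<in> A \<inter> {b<..b + c}"
      then have "x - b \<in> A \<inter> {0<..c}" using per[OF b, of "x - b"] by auto
      then show "x \<in> (+) b ` (A \<inter> {0<..c})" by (auto intro!: image_eqI[of _ _ "x - b"])
    next
      fix x assume "x \<in> (+) b ` (A \<inter> {0<..c})"
      then show "x \<in> A \<inter> {b<..b + c}" using per[OF b] by (auto simp: add.commute)
    qed
    \<comment> \<open>The detour through the completed measure is for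
      \<open>measure_translation\<close>, which speaks of Lebesgue measure.\<close>
    have leb: "measure lborel (A \<inter> {a<..d}) = measure lebesgue (A \<inter> {a<..d})" for a d
      by (rule measure_completion[symmetric]) simp
    show ?thesis
      unfolding m_def leb unfolding eq by (rule measure_translation)
  qed
  have mult: "m (real k * e) = real k * m e" if e: "e \<in> dyadic" "0 \<le> e" for k e
  proof (induction k)
    case 0
    show ?case by (simp add: m_def)
  next
    case (Suc k)
    have "real k * e \<in> dyadic"
    proof (induction k)
      case 0
      show ?case using dyadic_of_int[of 0 0] by simp
    next
      case (Suc k)
      then show ?case using dyadic_add[OF Suc e(1)] by (simp add: algebra_simps)
    qed
    then show ?case
      using Suc split[of "real k * e" "real k * e + e"] trans[of "real k * e" e] e(2)
      by (simp add: algebra_simps)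
  qed
  have m_eq: "m c = m 1 * c" if c: "c \<in> dyadic" "0 \<le> c" for c
  proof -
    obtain a :: int and n :: nat where an: "c = of_int a / 2 ^ n"
      using c by (auto simp: dyadic_def)
    define e :: real where "e = 1 / 2 ^ n"
    have e: "e \<in> dyadic" "0 \<le> e" using dyadic_of_int[of 1 n] by (auto simp: e_def)
    have "0 \<le> c * 2 ^ n" using c(2) by simp
    then have "0 \<le> a" by (simp add: an)
    then have ce: "c = real (nat a) * e" by (simp add: an e_def)
    have "m 1 = real (2 ^ n) * m e"
      using mult[OF e, of "2 ^ n"] by (simp add: e_def)
    then show ?thesis
      unfolding ce mult[OF e] by (simp add: e_def field_simps)
  qed
  have "AE x in \<mu>. indicator A x - m 1 = 0"
  proof (rule AE_zero_of_dyadic_integrals_real)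
    have Am: "A \<inter> space \<mu> \<in> sets \<mu>" by (auto simp: sets_unit_iff space_unit)
    show int: "integrable \<mu> (\<lambda>x. indicator A x - m 1)"
      by (intro Bochner_Integration.integrable_diff unit.integrable_const
        unit.integrable_const_bound[where B = 1] AE_I2 indicator_measurable_unit A)
        (auto simp: indicator_def)
    fix c :: real assume c: "c \<in> dyadic" "0 \<le> c" "c \<le> 1"
    have "(\<integral>x. indicator {c<..1} x * (indicator A x - m 1) \<partial>\<mu>)
        = (\<integral>x. indicator {0..1} x *\<^sub>R (indicator {c<..1} x * (indicator A x - m 1)) \<partial>lborel)"
      by (rule integral_restrict_space) simp
    also have "\<dots> = (\<integral>x. indicator (A \<inter> {c<..1}) x - m 1 * indicator {c<..1} x \<partial>lborel)"
      by (rule Bochner_Integration.integral_cong) (use c in \<open>auto simp: indicator_def\<close>)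
    also have "\<dots> = measure lborel (A \<inter> {c<..1}) - m 1 * measure lborel {c<..1}"
      using fm[of c 1] c
      by (subst Bochner_Integration.integral_diff) (auto simp: fmeasurable_def)
    also have "measure lborel (A \<inter> {c<..1}) = m 1 - m c" using split[of c 1] c by simp
    also have "\<dots> - m 1 * measure lborel {c<..1} = 0"
      using c m_eq[OF c(1,2)] by (simp add: algebra_simps)
    finally show "(\<integral>x. indicator {c<..1} x * (indicator A x - m 1) \<partial>\<mu>) = 0" .
  qed
  then have "AE x in \<mu>. indicator A x = m 1" by simp
  show ?thesis
  \<comment> \<open>An indicator that is almost everywhere constant and not equal to 1 can only be
    0.\<close>
  proof (cases "m 1 = 1")
    case True
    have "AE x in \<mu>. x \<in> A"
      using \<open>AE x in \<mu>. indicator A x = m 1\<close>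
      by eventually_elim (auto simp: True indicator_def split: if_splits)
    then show ?thesis ..
  next
    case False
    have "AE x in \<mu>. x \<notin> A"
      using \<open>AE x in \<mu>. indicator A x = m 1\<close>
      by eventually_elim (use False in \<open>auto simp: indicator_def split: if_splits\<close>)
    then show ?thesis ..
  qed
qed

lemma l2_eq_zeroI:
  assumes "AE x in \<mu>. rep_l2 v x = 0"
  shows "v = 0"
proof -
  have "square_integrable (\<lambda>_. 0)" by (rule square_integrable_zero)
  then have "AE x in \<mu>. rep_l2 0 x = 0"
    unfolding zero_l2_def by (rule rep_abs_l2)
  with assms have "AE x in \<mu>. rep_l2 v x = rep_l2 0 x" by eventually_elim simp
  then show ?thesis by (rule l2_eqI)
qed

text \<open>Every nonzero vector is cyclic: almost every point has a dyadic translate in the support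
  of \<open>u\<close>, and \<open>w\<close> must vanish at such a point.\<close>

lemma koopman_cyclic:
  assumes orth: "\<And>g. g \<in> thompson_carrier \<Longrightarrow> cinner (koopman_rep s g u) w = 0"
    and u: "u \<noteq> 0"
  shows "w = 0"
proof -
  define A where "A = {x \<in> {0<..<1}. rep_l2 u x \<noteq> 0}"
  have A: "A \<in> sets borel"
  proof -
    have "{x \<in> space \<mu>. rep_l2 u x \<noteq> 0} \<in> sets \<mu>"
      using rep_l2_measurable[of u] by measurable
    then have "{x \<in> space \<mu>. rep_l2 u x \<noteq> 0} \<in> sets borel"
      unfolding sets_unit_iff by (rule conjunct1)
    then have "{x \<in> space \<mu>. rep_l2 u x \<noteq> 0} \<inter> {0<..<1} \<in> sets borel"
      by (rule sets.Int) simp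
    also have "{x \<in> space \<mu>. rep_l2 u x \<noteq> 0} \<inter> {0<..<1} = A"
      by (auto simp: A_def space_unit)
    finally show ?thesis .
  qed
  \<comment> \<open>The saturation of the support of \<open>u\<close> under dyadic translations of
    the whole line: periodic by construction, and not null since it contains the support.\<close>
  define B where "B = (\<Union>t\<in>dyadic. (\<lambda>x. x + t) -` A)"
  have B: "B \<in> sets borel"
    unfolding B_def
  proof (rule sets.countable_UN''[OF countable_dyadic])
    fix t :: real
    have "(\<lambda>x. x + t) \<in> borel_measurable borel" by measurable
    from measurable_sets[OF this A] show "(\<lambda>x. x + t) -` A \<in> sets borel" by simp
  qed
  have per: "x + t \<in> B \<longleftrightarrow> x \<in> B" if t: "t \<in> dyadic" for x t
  proof
    assume "x + t \<in> B"
    then obtain r where "r \<in> dyadic" "x + t + r \<in> A" by (auto simp: B_def)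
    then have "t + r \<in> dyadic" "x + (t + r) \<in> A" using dyadic_add[OF t] by (auto simp: add.assoc)
    then show "x \<in> B" unfolding B_def by blast
  next
    assume "x \<in> B"
    then obtain r where "r \<in> dyadic" "x + r \<in> A" by (auto simp: B_def)
    then have "r - t \<in> dyadic" "x + t + (r - t) \<in> A" using dyadic_diff[OF _ t] by auto
    then show "x + t \<in> B" unfolding B_def by blast
  qed
  have zero: "0 \<in> dyadic" using dyadic_of_int[of 0 0] by simp
  have "\<not> (AE x in \<mu>. x \<notin> B)"
  proof
    assume "AE x in \<mu>. x \<notin> B"
    then have "AE x in \<mu>. rep_l2 u x = 0"
      using AE_space[of \<mu>] AE_neq[of 0] AE_neq[of 1]
    proof eventually_elim
      case (elim x)
      then have x: "x \<in> {0<..<1}" by (simp add: space_unit)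
      have "x + 0 \<notin> A" using elim(1) zero unfolding B_def by blast
      with x show ?case by (simp add: A_def)
    qed
    with u show False using l2_eq_zeroI by blast
  qed
  then have "AE x in \<mu>. x \<in> B"
    using dyadic_periodic_null_or_conull[OF B per] by blast
  \<comment> \<open>Countability of the dyadics allows one null set for all t, which is needed
    because the t used below depends on x.\<close>
  moreover have "AE x in \<mu>. \<forall>t\<in>dyadic. x \<in> {0<..<1} \<longrightarrow> x + t \<in> {0<..<1}
      \<longrightarrow> rep_l2 u (x + t) = 0 \<or> rep_l2 w x = 0"
    by (subst AE_ball_countable[OF countable_dyadic])
      (intro ballI koopman_orthogonal_translates[OF orth])
  ultimately have "AE x in \<mu>. rep_l2 w x = 0"
    using AE_space[of \<mu>] AE_neq[of 0] AE_neq[of 1]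
  proof eventually_elim
    case (elim x)
    then have x: "x \<in> {0<..<1}" by (simp add: space_unit)
    obtain t where t: "t \<in> dyadic" "x + t \<in> A" using elim(1) by (auto simp: B_def)
    then have "x + t \<in> {0<..<1}" "rep_l2 u (x + t) \<noteq> 0" by (auto simp: A_def)
    with elim(2) x t(1) show ?case by blast
  qed
  then show ?thesis by (rule l2_eq_zeroI)
qed

lemma l2_nontrivial: "(UNIV :: l2 set) \<noteq> {0}"
proof
  assume triv: "(UNIV :: l2 set) = {0}"
  have one: "square_integrable (\<lambda>_. 1)" by (simp add: square_integrable_def)
  have eq: "abs_l2 (\<lambda>_. 1) = abs_l2 (\<lambda>_. 0)"
    using triv by (metis UNIV_I singletonD)
  have "AE x in \<mu>. rep_l2 (abs_l2 (\<lambda>_. 0)) x = 1"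
    using rep_abs_l2[OF one] unfolding eq .
  then have "AE x in \<mu>. False"
    using rep_abs_l2[OF square_integrable_zero] by eventually_elim simp
  then have "emeasure \<mu> (space \<mu>) = 0"
    by (subst (asm) AE_iff_measurable[OF sets.top]) auto
  then show False by (simp add: space_unit emeasure_restrict_space)
qed

theorem proposition5:
  fixes s :: real
  shows "irreducible_unitary_rep thompson_F (koopman_rep s)"
  unfolding irreducible_unitary_rep_def
proof (intro conjI koopman_unitary_rep l2_nontrivial allI impI)
  fix W :: "l2 set"
  assume W: "closed W \<and> module.subspace scaleC W
    \<and> (\<forall>g\<in>carrier thompson_F. koopman_rep s g ` W \<subseteq> W)"
  interpret C: vector_space "scaleC :: complex \<Rightarrow> l2 \<Rightarrow> l2" by (rule vector_space_scaleC)
  have sub: "C.subspace W" using W by blast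
  have real: "subspace W"
    using C.subspace_0[OF sub] C.subspace_add[OF sub] C.subspace_scale[OF sub]
    by (intro subspaceI) (simp_all add: scaleR_scaleC)
  show "W = {0} \<or> W = UNIV"
  proof (rule ccontr)
    assume neg: "\<not> (W = {0} \<or> W = UNIV)"
    then obtain u where u: "u \<in> W" "u \<noteq> 0" using C.subspace_0[OF sub] by blast
    obtain x where "x \<notin> W" using neg by blast
    with W real obtain y where y: "y \<noteq> 0" and orth: "\<And>w. w \<in> W \<Longrightarrow> inner w y = 0"
      using exists_orthogonal[of W x] by metis
    \<comment> \<open>The vector \<open>y\<close> comes from real orthogonality, which controls the
      real part only. Testing against -i times w, which lies in \<open>W\<close> since
      \<open>W\<close> is a complex subspace, gives the imaginary part.\<close>
    have "cinner w y = 0" if w: "w \<in> W" for w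
    proof -
      have "Re (cinner w y) = 0" using orth[OF w] by (simp add: inner_eq_Re_cinner)
      moreover have "Re (cinner ((- \<i>) *\<^sub>C w) y) = 0"
        using orth[OF C.subspace_scale[OF sub w, of "- \<i>"]] by (simp add: inner_eq_Re_cinner)
      then have "Re (- \<i> * cinner w y) = 0" by (simp only: cinner_scaleC_left)
      then have "Im (cinner w y) = 0" by simp
      ultimately show ?thesis by (simp add: complex_eq_iff)
    qed
    moreover have "koopman_rep s g u \<in> W" if "g \<in> thompson_carrier" for g
      using W u(1) that unfolding carrier_thompson_F by blast
    ultimately have "y = 0" using koopman_cyclic[OF _ u(2)] by metis
    with y show False ..
  qed
qed

end
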